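(* Let $(L,Y)$ be a bundle gerbe over a smooth manifold $M$ and let $\mathcal L=\mathcal L(L,Y)$ be the associated gerbe over the groupoid $\mathcal G(Y,M)$. The category of bundle gerbe modules over $(L,Y)$ is equivalent to the category of $\mathcal L(L,Y)$-twisted vector bundles over $\mathcal G(Y,M)$. Moreover, $${}^{\mathcal L}K_{\mathrm{gpd}}(\mathcal G(Y,M))\cong K_{\mathrm{bg}}(M,L).$$
   Context: Bundle gerbes. A bundle gerbe over $M$ is a pair $(L,Y)$ where $\pi:Y\to M$ is a surjective submersion and $L\to Y^{[2]}=Y\times_MY$ is a complex line bundle with isomorphisms $L_{(y,y)}\cong\mathbf C$, $L_{(y_1,y_2)}\cong L_{(y_2,y_1)}^*$, $L_{(y_1,y_2)}\otimes L_{(y_2,y_3)}\cong L_{(y_1,y_3)}$ (smooth and associative). Bundle gerbe modules. A bundle gerbe module $(E,L,Y,M)$ is a hermitian vector bundle $E\to Y$ with an isomorphism of bundles over $Y^{[2]}$ given fiberwise by $\phi:L_{(y_1,y_2)}\otimes E_{y_2}\to E_{y_1}$, such that the compositions $L_{(y_1,y_2)}\otimes(L_{(y_2,y_3)}\otimes E_{y_3})\to L_{(y_1,y_2)}\otimes E_{y_2}\to E_{y_1}$ and $(L_{(y_1,y_2)}\otimes L_{(y_2,y_3)})\otimes E_{y_3}\to L_{(y_1,y_3)}\otimes E_{y_3}\to E_{y_1}$ coincide. $K_{\mathrm{bg}}(M,L)$ is the Grothendieck group of the semigroup of (isomorphism classes of) bundle gerbe modules $(E,L,Y,M)$ with $(L,Y,M)$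 fixed. Groupoid side. $\mathcal G(Y,M)$ is the groupoid with objects $Y$, arrows $Y^{[2]}$, $s(y_1,y_2)=y_1$, $t(y_1,y_2)=y_2$, $m((y_1,y_2),(y_2,y_3))=(y_1,y_3)$. A gerbe over a groupoid $\mathcal R\rightrightarrows\mathcal U$ is a complex line bundle $\mathcal L\to\mathcal R$ with $i^*\mathcal L\cong\mathcal L^{-1}$ and a trivialization of $\pi_1^*\mathcal L\otimes\pi_2^*\mathcal L\otimes m^*i^*\mathcal L$ satisfying the 2-cocycle condition. The line bundle $L\to Y^{[2]}$ with its product is such a gerbe over $\mathcal G(Y,M)$, denoted $\mathcal L(L,Y)$. An $\mathcal L$-twisted vector bundle over $\mathcal R\rightrightarrows\mathcal U$ is a vector bundle $E\to\mathcal U$ together with a given isomorphism $\mathcal L\otimes t^*E\cong s^*E$ compatible with the gerbe product. ${}^{\mathcal L}K_{\mathrm{gpd}}$ is the Grothendieck group of isomorphism classes of $\mathcal L$-twisted vector bundles under direct sum. In both categories the morphisms are vector bundle maps over $Y$ commuting with the given isomorphisms. *)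

theory Defs
  imports
    "HOL-Analysis.Derivative"
    "HOL-Analysis.Abstract_Topological_Spaces"
    "HOL-Analysis.Abstract_Euclidean_Space"
    "HOL-Algebra.Group"
    "Jordan_Normal_Form.Schur_Decomposition"
begin

section \<open>Smooth functions on open subsets of Euclidean space\<close>

text \<open>
  \<open>\<real>\<^sup>n\<close> is \<^const>\<open>Euclidean_space\<close> \<open>n\<close>, whose points are the \<open>x :: nat \<Rightarrow> real\<close>
  with \<open>x i = 0\<close> for \<open>i \<ge> n\<close>. The predicates below presuppose that
  \<open>S\<close> is open in it.
\<close>

fun Ck_on :: "nat \<Rightarrow> nat \<Rightarrow> (nat \<Rightarrow> real) set \<Rightarrow> ((nat \<Rightarrow> real) \<Rightarrow> 'b::real_normed_vector) \<Rightarrow> bool" where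
  "Ck_on n 0 S f \<longleftrightarrow> continuous_map (subtopology (Euclidean_space n) S) euclidean f"
| "Ck_on n (Suc k) S f \<longleftrightarrow>
     continuous_map (subtopology (Euclidean_space n) S) euclidean f \<and>
     (\<forall>i<n. \<exists>g. (\<forall>x\<in>S. ((\<lambda>t. f (x(i := t))) has_vector_derivative g x) (at (x i))) \<and> Ck_on n k S g)"

definition Cinf_on :: "nat \<Rightarrow> (nat \<Rightarrow> real) set \<Rightarrow> ((nat \<Rightarrow> real) \<Rightarrow> 'b::real_normed_vector) \<Rightarrow> bool" where
  "Cinf_on n S f \<longleftrightarrow> (\<forall>k. Ck_on n k S f)"

definition partial_deriv :: "nat \<Rightarrow> ((nat \<Rightarrow> real) \<Rightarrow> real) \<Rightarrow> (nat \<Rightarrow> real) \<Rightarrow> real" where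
  "partial_deriv i f x = vector_derivative (\<lambda>t. f (x(i := t))) (at (x i))"


section \<open>Smooth manifolds\<close>

type_synonym 'x chart = "'x set \<times> ('x \<Rightarrow> nat \<Rightarrow> real)"

record 'x manifold =
  mtop :: "'x topology"
  mdim :: nat
  matlas :: "'x chart set"

abbreviation pts :: "'x manifold \<Rightarrow> 'x set" where
  "pts X \<equiv> topspace (mtop X)"

definition is_chart :: "'x manifold \<Rightarrow> 'x chart \<Rightarrow> bool" where
  "is_chart X = (\<lambda>(U, \<phi>).
     openin (mtop X) U \<and> openin (Euclidean_space (mdim X)) (\<phi> ` U) \<and>
     homeomorphic_map (subtopology (mtop X) U) (subtopology (Euclidean_space (mdim X)) (\<phi> ` U)) \<phi>)"

definition smooth_transition :: "nat \<Rightarrow> 'x chart \<Rightarrow> 'x chart \<Rightarrow> bool" where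
  "smooth_transition n = (\<lambda>(U, \<phi>) (V, \<psi>).
     \<forall>j<n. Cinf_on n (\<phi> ` (U \<inter> V)) (\<lambda>p. \<psi> (inv_into U \<phi> p) j))"

definition smooth_manifold :: "'x manifold \<Rightarrow> bool" where
  "smooth_manifold X \<longleftrightarrow>
     Hausdorff_space (mtop X) \<and> second_countable (mtop X) \<and>
     (\<forall>c\<in>matlas X. is_chart X c) \<and>
     (\<Union>(U, \<phi>)\<in>matlas X. U) = pts X \<and>
     (\<forall>c\<in>matlas X. \<forall>d\<in>matlas X. smooth_transition (mdim X) c d)"

definition maximal_atlas :: "'x manifold \<Rightarrow> 'x chart set" where
  "maximal_atlas X = {c. is_chart X c \<and>
     (\<forall>d\<in>matlas X. smooth_transition (mdim X) c d \<and> smooth_transition (mdim X) d c)}"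

definition smooth_fun :: "'x manifold \<Rightarrow> 'x set \<Rightarrow> ('x \<Rightarrow> complex) \<Rightarrow> bool" where
  "smooth_fun X W f \<longleftrightarrow> openin (mtop X) W \<and>
     (\<forall>(U, \<phi>)\<in>matlas X. Cinf_on (mdim X) (\<phi> ` (U \<inter> W)) (\<lambda>p. f (inv_into U \<phi> p)))"

definition smooth_map :: "'x manifold \<Rightarrow> 'z manifold \<Rightarrow> ('x \<Rightarrow> 'z) \<Rightarrow> bool" where
  "smooth_map X Z f \<longleftrightarrow> continuous_map (mtop X) (mtop Z) f \<and>
     (\<forall>(U, \<phi>)\<in>matlas X. \<forall>(V, \<psi>)\<in>matlas Z. \<forall>j<mdim Z.
        Cinf_on (mdim X) (\<phi> ` {x\<in>U. f x \<in> V}) (\<lambda>p. \<psi> (f (inv_into U \<phi> p)) j))"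

definition submersion :: "'x manifold \<Rightarrow> 'z manifold \<Rightarrow> ('x \<Rightarrow> 'z) \<Rightarrow> bool" where
  "submersion X Z f \<longleftrightarrow> smooth_map X Z f \<and>
     (\<forall>(U, \<phi>)\<in>matlas X. \<forall>(V, \<psi>)\<in>matlas Z. \<forall>x\<in>U. f x \<in> V \<longrightarrow>
        (\<forall>w::nat \<Rightarrow> real. \<exists>v::nat \<Rightarrow> real. \<forall>j<mdim Z.
           (\<Sum>i<mdim X. partial_deriv i (\<lambda>p. \<psi> (f (inv_into U \<phi> p)) j) (\<phi> x) * v i) = w j))"

definition surjective_submersion :: "'x manifold \<Rightarrow> 'z manifold \<Rightarrow> ('x \<Rightarrow> 'z) \<Rightarrow> bool" where
  "surjective_submersion X Z f \<longleftrightarrow> submersion X Z f \<and> f ` pts X = pts Z"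

definition prod_manifold :: "'x manifold \<Rightarrow> 'z manifold \<Rightarrow> ('x \<times> 'z) manifold" where
  "prod_manifold X Z = \<lparr>
     mtop = prod_topology (mtop X) (mtop Z),
     mdim = mdim X + mdim Z,
     matlas = {(U \<times> V, \<lambda>(x, z) i. if i < mdim X then \<phi> x i else \<psi> z (i - mdim X)) |U \<phi> V \<psi>.
                 (U, \<phi>) \<in> matlas X \<and> (V, \<psi>) \<in> matlas Z}\<rparr>"

text \<open>
  The structure of an embedded \<open>k\<close>-dimensional submanifold on a subset \<open>S\<close>: the charts are
  the slice charts. As \<open>\<real>\<^sup>k\<close> is literally the subset \<open>{x. x i = 0 for i \<ge> k}\<close> of \<open>\<real>\<^sup>n\<close>, a
  slice chart of the ambient manifold restricts without change of its values.
\<close>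

definition submanifold :: "'x manifold \<Rightarrow> 'x set \<Rightarrow> nat \<Rightarrow> 'x manifold" where
  "submanifold X S k = \<lparr>
     mtop = subtopology (mtop X) S,
     mdim = k,
     matlas = {(U \<inter> S, \<phi>) |U \<phi>. (U, \<phi>) \<in> maximal_atlas X \<and>
                 \<phi> ` (U \<inter> S) = \<phi> ` U \<inter> topspace (Euclidean_space k)}\<rparr>"


section \<open>Complex vector bundles\<close>

definition kron :: "complex mat \<Rightarrow> complex mat \<Rightarrow> complex mat" (infixl \<open>\<otimes>\<^sub>k\<close> 70) where
  "A \<otimes>\<^sub>k B = Matrix.mat (dim_row A * dim_row B) (dim_col A * dim_col B)
     (\<lambda>(i, j). A $$ (i div dim_row B, j div dim_col B) * B $$ (i mod dim_row B, j mod dim_col B))"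

definition dsum :: "complex mat \<Rightarrow> complex mat \<Rightarrow> complex mat" (infixl \<open>\<oplus>\<^sub>d\<close> 65) where
  "A \<oplus>\<^sub>d B = four_block_mat A (0\<^sub>m (dim_row A) (dim_col B)) (0\<^sub>m (dim_row B) (dim_col A)) B"

abbreviation minv :: "complex mat \<Rightarrow> complex mat" where
  "minv A \<equiv> the (mat_inverse A)"

text \<open>
  A vector bundle over \<open>X\<close> has as fibre over \<open>x\<close> the space \<open>\<complex>\<^sup>r\<close>, \<open>r = vb_rank E x\<close>; this amounts
  to choosing a basis in every fibre separately, with no continuity whatsoever. The topology and
  smooth structure are carried by the local trivializations \<open>(U, A)\<close>, whose restriction
  \<open>\<complex>\<^sup>r \<rightarrow> E\<^sub>x\<close> to the fibre over \<open>x \<in> U\<close> is \<open>A x\<close>. Thus every vector bundle is isomorphic to one of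
  this form, and bundles of this form need not be trivial.
  Fixing the fibres in this way makes all bundles over \<open>X\<close> elements of one type, closed under
  pullback, \<open>\<oplus>\<close>, \<open>\<otimes>\<close> and duals. Tensor products use the Kronecker ordering of bases, for which
  \<open>\<otimes>\<close> is strictly associative, and \<open>\<complex>\<^sup>1 \<otimes> (V \<oplus> W) = (\<complex>\<^sup>1 \<otimes> V) \<oplus> (\<complex>\<^sup>1 \<otimes> W)\<close> strictly.
\<close>

record 'x vbundle =
  vb_rank :: "'x \<Rightarrow> nat"
  vb_triv :: "('x set \<times> ('x \<Rightarrow> complex mat)) set"

definition smooth_mat :: "'x manifold \<Rightarrow> 'x set \<Rightarrow> ('x \<Rightarrow> complex mat) \<Rightarrow> bool" where
  "smooth_mat X W T \<longleftrightarrow>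
     (\<forall>i j. smooth_fun X {x\<in>W. i < dim_row (T x) \<and> j < dim_col (T x)} (\<lambda>x. T x $$ (i, j)))"

definition vector_bundle :: "'x manifold \<Rightarrow> 'x vbundle \<Rightarrow> bool" where
  "vector_bundle X E \<longleftrightarrow>
     (\<forall>(U, A)\<in>vb_triv E. openin (mtop X) U \<and>
        (\<forall>x\<in>U. \<forall>y\<in>U. vb_rank E x = vb_rank E y) \<and>
        (\<forall>x\<in>U. A x \<in> carrier_mat (vb_rank E x) (vb_rank E x) \<and> invertible_mat (A x))) \<and>
     (\<Union>(U, A)\<in>vb_triv E. U) = pts X \<and>
     (\<forall>(U, A)\<in>vb_triv E. \<forall>(V, B)\<in>vb_triv E. smooth_mat X (U \<inter> V) (\<lambda>x. minv (B x) * A x))"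

definition line_bundle :: "'x manifold \<Rightarrow> 'x vbundle \<Rightarrow> bool" where
  "line_bundle X L \<longleftrightarrow> vector_bundle X L \<and> (\<forall>x\<in>pts X. vb_rank L x = 1)"

definition bundle_map :: "'x manifold \<Rightarrow> 'x vbundle \<Rightarrow> 'x vbundle \<Rightarrow> ('x \<Rightarrow> complex mat) \<Rightarrow> bool" where
  "bundle_map X E F T \<longleftrightarrow>
     (\<forall>x\<in>pts X. T x \<in> carrier_mat (vb_rank F x) (vb_rank E x)) \<and>
     (\<forall>(U, A)\<in>vb_triv E. \<forall>(V, B)\<in>vb_triv F. smooth_mat X (U \<inter> V) (\<lambda>x. minv (B x) * T x * A x))"

definition bundle_iso :: "'x manifold \<Rightarrow> 'x vbundle \<Rightarrow> 'x vbundle \<Rightarrow> ('x \<Rightarrow> complex mat) \<Rightarrow> bool" where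
  "bundle_iso X E F T \<longleftrightarrow> bundle_map X E F T \<and> (\<forall>x\<in>pts X. invertible_mat (T x))"

definition trivial_line :: "'x manifold \<Rightarrow> 'x vbundle" where
  "trivial_line X = \<lparr>vb_rank = (\<lambda>_. 1), vb_triv = {(pts X, \<lambda>_. 1\<^sub>m 1)}\<rparr>"

definition zero_bundle :: "'x manifold \<Rightarrow> 'x vbundle" where
  "zero_bundle X = \<lparr>vb_rank = (\<lambda>_. 0), vb_triv = {(pts X, \<lambda>_. 1\<^sub>m 0)}\<rparr>"

definition pullback :: "'x manifold \<Rightarrow> ('x \<Rightarrow> 'z) \<Rightarrow> 'z vbundle \<Rightarrow> 'x vbundle" where
  "pullback X f E = \<lparr>vb_rank = vb_rank E \<circ> f,
     vb_triv = {({x\<in>pts X. f x \<in> U}, A \<circ> f) |U A. (U, A) \<in> vb_triv E}\<rparr>"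

definition tensor_bundle :: "'x vbundle \<Rightarrow> 'x vbundle \<Rightarrow> 'x vbundle" where
  "tensor_bundle E F = \<lparr>vb_rank = (\<lambda>x. vb_rank E x * vb_rank F x),
     vb_triv = {(U \<inter> V, \<lambda>x. A x \<otimes>\<^sub>k B x) |U A V B. (U, A) \<in> vb_triv E \<and> (V, B) \<in> vb_triv F}\<rparr>"

definition sum_bundle :: "'x vbundle \<Rightarrow> 'x vbundle \<Rightarrow> 'x vbundle" where
  "sum_bundle E F = \<lparr>vb_rank = (\<lambda>x. vb_rank E x + vb_rank F x),
     vb_triv = {(U \<inter> V, \<lambda>x. A x \<oplus>\<^sub>d B x) |U A V B. (U, A) \<in> vb_triv E \<and> (V, B) \<in> vb_triv F}\<rparr>"

text \<open>A covector is given by its coefficients, so that \<open>\<xi> \<in> E\<^sub>x\<^sup>*\<close> is evaluated by \<open>v \<mapsto> \<xi>\<^sup>T v\<close>.\<close>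

definition dual_bundle :: "'x vbundle \<Rightarrow> 'x vbundle" where
  "dual_bundle E = \<lparr>vb_rank = vb_rank E,
     vb_triv = {(U, \<lambda>x. transpose_mat (minv (A x))) |U A. (U, A) \<in> vb_triv E}\<rparr>"

text \<open>The metric is \<open>\<langle>v, w\<rangle>\<^sub>x = w\<^sup>* (h x) v\<close>; its Gram matrix in a local frame \<open>A\<close> is \<open>A\<^sup>* h A\<close>.\<close>

definition hermitian_metric :: "'x manifold \<Rightarrow> 'x vbundle \<Rightarrow> ('x \<Rightarrow> complex mat) \<Rightarrow> bool" where
  "hermitian_metric X E h \<longleftrightarrow>
     (\<forall>x\<in>pts X. h x \<in> carrier_mat (vb_rank E x) (vb_rank E x) \<and> mat_adjoint (h x) = h x \<and>
        (\<forall>v\<in>carrier_vec (vb_rank E x). v \<noteq> 0\<^sub>v (vb_rank E x) \<longrightarrow> Re ((h x *\<^sub>v v) \<bullet>c v) > 0)) \<and>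
     (\<forall>(U, A)\<in>vb_triv E. smooth_mat X U (\<lambda>x. mat_adjoint (A x) * h x * A x))"


section \<open>Bundle gerbes and their modules\<close>

text \<open>
  \<open>bg_unit\<close>, \<open>bg_dual\<close> and \<open>bg_prod\<close> are the fibrewise isomorphisms \<open>L\<^bsub>(y,y)\<^esub> \<rightarrow> \<complex>\<close>,
  \<open>L\<^bsub>(y1,y2)\<^esub> \<rightarrow> L\<^bsub>(y2,y1)\<^esub>\<^sup>*\<close> and \<open>L\<^bsub>(y1,y2)\<^esub> \<otimes> L\<^bsub>(y2,y3)\<^esub> \<rightarrow> L\<^bsub>(y1,y3)\<^esub>\<close>.
\<close>

record ('y, 'm) bundle_gerbe =
  bg_Y :: "'y manifold"
  bg_M :: "'m manifold"
  bg_proj :: "'y \<Rightarrow> 'm"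
  bg_L :: "('y \<times> 'y) vbundle"
  bg_unit :: "'y \<Rightarrow> complex mat"
  bg_dual :: "'y \<times> 'y \<Rightarrow> complex mat"
  bg_prod :: "'y \<times> 'y \<times> 'y \<Rightarrow> complex mat"

text \<open>
  The fibre products \<open>Y\<^sup>[\<^sup>2\<^sup>]\<close> and \<open>Y\<^sup>[\<^sup>3\<^sup>]\<close> of a submersion are embedded submanifolds, of
  codimension \<open>dim M\<close> and \<open>2 dim M\<close>.
\<close>

definition Y2 :: "'y manifold \<Rightarrow> 'm manifold \<Rightarrow> ('y \<Rightarrow> 'm) \<Rightarrow> ('y \<times> 'y) manifold" where
  "Y2 Y M \<pi> = submanifold (prod_manifold Y Y)
     {(y1, y2). \<pi> y1 = \<pi> y2} (2 * mdim Y - mdim M)"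

definition Y3 :: "'y manifold \<Rightarrow> 'm manifold \<Rightarrow> ('y \<Rightarrow> 'm) \<Rightarrow> ('y \<times> 'y \<times> 'y) manifold" where
  "Y3 Y M \<pi> = submanifold (prod_manifold Y (prod_manifold Y Y))
     {(y1, y2, y3). \<pi> y1 = \<pi> y2 \<and> \<pi> y2 = \<pi> y3} (3 * mdim Y - 2 * mdim M)"

abbreviation bg_Y2 :: "('y, 'm) bundle_gerbe \<Rightarrow> ('y \<times> 'y) manifold" where
  "bg_Y2 B \<equiv> Y2 (bg_Y B) (bg_M B) (bg_proj B)"

abbreviation bg_Y3 :: "('y, 'm) bundle_gerbe \<Rightarrow> ('y \<times> 'y \<times> 'y) manifold" where
  "bg_Y3 B \<equiv> Y3 (bg_Y B) (bg_M B) (bg_proj B)"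

definition is_bundle_gerbe :: "('y, 'm) bundle_gerbe \<Rightarrow> bool" where
  "is_bundle_gerbe B \<longleftrightarrow>
     smooth_manifold (bg_M B) \<and> smooth_manifold (bg_Y B) \<and>
     surjective_submersion (bg_Y B) (bg_M B) (bg_proj B) \<and>
     line_bundle (bg_Y2 B) (bg_L B) \<and>
     bundle_iso (bg_Y B) (pullback (bg_Y B) (\<lambda>y. (y, y)) (bg_L B)) (trivial_line (bg_Y B)) (bg_unit B) \<and>
     bundle_iso (bg_Y2 B) (bg_L B)
       (dual_bundle (pullback (bg_Y2 B) (\<lambda>(y1, y2). (y2, y1)) (bg_L B))) (bg_dual B) \<and>
     bundle_iso (bg_Y3 B)
       (tensor_bundle (pullback (bg_Y3 B) (\<lambda>(y1, y2, y3). (y1, y2)) (bg_L B))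
                      (pullback (bg_Y3 B) (\<lambda>(y1, y2, y3). (y2, y3)) (bg_L B)))
       (pullback (bg_Y3 B) (\<lambda>(y1, y2, y3). (y1, y3)) (bg_L B)) (bg_prod B) \<and>
     (\<forall>y1 y2 y3 y4. (y1, y2, y3) \<in> pts (bg_Y3 B) \<longrightarrow> (y2, y3, y4) \<in> pts (bg_Y3 B) \<longrightarrow>
        bg_prod B (y1, y3, y4) * (bg_prod B (y1, y2, y3) \<otimes>\<^sub>k 1\<^sub>m (vb_rank (bg_L B) (y3, y4))) =
        bg_prod B (y1, y2, y4) * (1\<^sub>m (vb_rank (bg_L B) (y1, y2)) \<otimes>\<^sub>k bg_prod B (y2, y3, y4)))"

record 'y bg_module =
  bgm_bundle :: "'y vbundle"
  bgm_metric :: "'y \<Rightarrow> complex mat"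
  bgm_act :: "'y \<times> 'y \<Rightarrow> complex mat"

definition is_bg_module :: "('y, 'm) bundle_gerbe \<Rightarrow> 'y bg_module \<Rightarrow> bool" where
  "is_bg_module B E \<longleftrightarrow>
     vector_bundle (bg_Y B) (bgm_bundle E) \<and>
     hermitian_metric (bg_Y B) (bgm_bundle E) (bgm_metric E) \<and>
     bundle_iso (bg_Y2 B)
       (tensor_bundle (bg_L B) (pullback (bg_Y2 B) snd (bgm_bundle E)))
       (pullback (bg_Y2 B) fst (bgm_bundle E)) (bgm_act E) \<and>
     (\<forall>(y1, y2, y3)\<in>pts (bg_Y3 B).
        bgm_act E (y1, y2) * (1\<^sub>m (vb_rank (bg_L B) (y1, y2)) \<otimes>\<^sub>k bgm_act E (y2, y3)) =
        bgm_act E (y1, y3) * (bg_prod B (y1, y2, y3) \<otimes>\<^sub>k 1\<^sub>m (vb_rank (bgm_bundle E) y3)))"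

definition bgm_hom :: "('y, 'm) bundle_gerbe \<Rightarrow> 'y bg_module \<Rightarrow> 'y bg_module \<Rightarrow> ('y \<Rightarrow> complex mat) set" where
  "bgm_hom B E F = {T \<in> extensional (pts (bg_Y B)).
     bundle_map (bg_Y B) (bgm_bundle E) (bgm_bundle F) T \<and>
     (\<forall>(y1, y2)\<in>pts (bg_Y2 B).
        T y1 * bgm_act E (y1, y2) =
        bgm_act F (y1, y2) * (1\<^sub>m (vb_rank (bg_L B) (y1, y2)) \<otimes>\<^sub>k T y2))}"

definition bgm_sum :: "'y bg_module \<Rightarrow> 'y bg_module \<Rightarrow> 'y bg_module" where
  "bgm_sum E F = \<lparr>
     bgm_bundle = sum_bundle (bgm_bundle E) (bgm_bundle F),
     bgm_metric = (\<lambda>y. bgm_metric E y \<oplus>\<^sub>d bgm_metric F y),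
     bgm_act = (\<lambda>p. bgm_act E p \<oplus>\<^sub>d bgm_act F p)\<rparr>"

definition bgm_zero :: "('y, 'm) bundle_gerbe \<Rightarrow> 'y bg_module" where
  "bgm_zero B = \<lparr>bgm_bundle = zero_bundle (bg_Y B),
     bgm_metric = (\<lambda>_. 1\<^sub>m 0), bgm_act = (\<lambda>_. 1\<^sub>m 0)\<rparr>"


section \<open>Groupoids, gerbes over them, and twisted vector bundles\<close>

text \<open>\<open>gcomp g h\<close> is used when \<open>gtgt g = gsrc h\<close>.\<close>

record ('u, 'r) groupoid =
  gobj :: "'u manifold"
  garr :: "'r manifold"
  gsrc :: "'r \<Rightarrow> 'u"
  gtgt :: "'r \<Rightarrow> 'u"
  gunit :: "'u \<Rightarrow> 'r"
  ginv :: "'r \<Rightarrow> 'r"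
  gcomp :: "'r \<Rightarrow> 'r \<Rightarrow> 'r"

definition composables :: "('u, 'r) groupoid \<Rightarrow> ('r \<times> 'r) manifold" where
  "composables G = submanifold (prod_manifold (garr G) (garr G))
     {(g, h). gtgt G g = gsrc G h} (2 * mdim (garr G) - mdim (gobj G))"

definition lie_groupoid :: "('u, 'r) groupoid \<Rightarrow> bool" where
  "lie_groupoid G \<longleftrightarrow>
     smooth_manifold (gobj G) \<and> smooth_manifold (garr G) \<and>
     surjective_submersion (garr G) (gobj G) (gsrc G) \<and>
     surjective_submersion (garr G) (gobj G) (gtgt G) \<and>
     smooth_map (gobj G) (garr G) (gunit G) \<and> smooth_map (garr G) (garr G) (ginv G) \<and>
     smooth_map (composables G) (garr G) (\<lambda>(g, h). gcomp G g h) \<and>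
     (\<forall>u\<in>pts (gobj G). gsrc G (gunit G u) = u \<and> gtgt G (gunit G u) = u) \<and>
     (\<forall>(g, h)\<in>pts (composables G).
        gsrc G (gcomp G g h) = gsrc G g \<and> gtgt G (gcomp G g h) = gtgt G h) \<and>
     (\<forall>g h k. (g, h) \<in> pts (composables G) \<longrightarrow> (h, k) \<in> pts (composables G) \<longrightarrow>
        gcomp G (gcomp G g h) k = gcomp G g (gcomp G h k)) \<and>
     (\<forall>g\<in>pts (garr G).
        gcomp G (gunit G (gsrc G g)) g = g \<and> gcomp G g (gunit G (gtgt G g)) = g \<and>
        gsrc G (ginv G g) = gtgt G g \<and> gtgt G (ginv G g) = gsrc G g \<and>
        gcomp G g (ginv G g) = gunit G (gsrc G g) \<and> gcomp G (ginv G g) g = gunit G (gtgt G g))"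

text \<open>
  \<open>gg_inv\<close> is the isomorphism \<open>i\<^sup>* L \<cong> L\<^sup>*\<close> over the arrows, and \<open>gg_triv\<close> the trivialization
  \<open>L\<^sub>g \<otimes> L\<^sub>h \<otimes> L\<^bsub>i(gh)\<^esub> \<rightarrow> \<complex>\<close> over the composable pairs.
\<close>

record 'r groupoid_gerbe =
  gg_L :: "'r vbundle"
  gg_inv :: "'r \<Rightarrow> complex mat"
  gg_triv :: "'r \<times> 'r \<Rightarrow> complex mat"

text \<open>
  For \<open>D : W \<rightarrow> V\<^sup>*\<close> the evaluation \<open>V \<otimes> W \<rightarrow> \<complex>\<close>, \<open>v \<otimes> w \<mapsto> D(w)(v)\<close>.
\<close>

definition ev_mat :: "complex mat \<Rightarrow> complex mat" where
  "ev_mat D = Matrix.mat 1 (dim_row D * dim_col D) (\<lambda>(_, j). D $$ (j div dim_col D, j mod dim_col D))"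

text \<open>
  The gerbe product \<open>L\<^sub>g \<otimes> L\<^sub>h \<rightarrow> L\<^bsub>gh\<^esub>\<close>: the map obtained from the trivialization by moving
  \<open>L\<^bsub>i(gh)\<^esub> \<cong> L\<^bsub>gh\<^esub>\<^sup>*\<close> to the other side. The 2-cocycle condition on the trivialization says that
  this product is associative.
\<close>

definition gg_prod :: "('u, 'r) groupoid \<Rightarrow> 'r groupoid_gerbe \<Rightarrow> 'r \<Rightarrow> 'r \<Rightarrow> complex mat" where
  "gg_prod G \<L> g h = (THE P.
     P \<in> carrier_mat (vb_rank (gg_L \<L>) (gcomp G g h)) (vb_rank (gg_L \<L>) g * vb_rank (gg_L \<L>) h) \<and>
     ev_mat (gg_inv \<L> (gcomp G g h)) * (P \<otimes>\<^sub>k 1\<^sub>m (vb_rank (gg_L \<L>) (ginv G (gcomp G g h))))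
       = gg_triv \<L> (g, h))"

definition is_groupoid_gerbe :: "('u, 'r) groupoid \<Rightarrow> 'r groupoid_gerbe \<Rightarrow> bool" where
  "is_groupoid_gerbe G \<L> \<longleftrightarrow>
     lie_groupoid G \<and> line_bundle (garr G) (gg_L \<L>) \<and>
     bundle_iso (garr G) (pullback (garr G) (ginv G) (gg_L \<L>)) (dual_bundle (gg_L \<L>)) (gg_inv \<L>) \<and>
     bundle_iso (composables G)
       (tensor_bundle
          (tensor_bundle (pullback (composables G) fst (gg_L \<L>)) (pullback (composables G) snd (gg_L \<L>)))
          (pullback (composables G) (\<lambda>(g, h). ginv G (gcomp G g h)) (gg_L \<L>)))
       (trivial_line (composables G)) (gg_triv \<L>) \<and>
     (\<forall>g h k. (g, h) \<in> pts (composables G) \<longrightarrow> (h, k) \<in> pts (composables G) \<longrightarrow>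
        gg_prod G \<L> (gcomp G g h) k * (gg_prod G \<L> g h \<otimes>\<^sub>k 1\<^sub>m (vb_rank (gg_L \<L>) k)) =
        gg_prod G \<L> g (gcomp G h k) * (1\<^sub>m (vb_rank (gg_L \<L>) g) \<otimes>\<^sub>k gg_prod G \<L> h k))"

record ('u, 'r) twisted_bundle =
  tvb_bundle :: "'u vbundle"
  tvb_act :: "'r \<Rightarrow> complex mat"

definition is_twisted_bundle ::
    "('u, 'r) groupoid \<Rightarrow> 'r groupoid_gerbe \<Rightarrow> ('u, 'r) twisted_bundle \<Rightarrow> bool" where
  "is_twisted_bundle G \<L> E \<longleftrightarrow>
     vector_bundle (gobj G) (tvb_bundle E) \<and>
     bundle_iso (garr G)
       (tensor_bundle (gg_L \<L>) (pullback (garr G) (gtgt G) (tvb_bundle E)))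
       (pullback (garr G) (gsrc G) (tvb_bundle E)) (tvb_act E) \<and>
     (\<forall>(g, h)\<in>pts (composables G).
        tvb_act E g * (1\<^sub>m (vb_rank (gg_L \<L>) g) \<otimes>\<^sub>k tvb_act E h) =
        tvb_act E (gcomp G g h) *
          (gg_prod G \<L> g h \<otimes>\<^sub>k 1\<^sub>m (vb_rank (tvb_bundle E) (gtgt G h))))"

definition tvb_hom :: "('u, 'r) groupoid \<Rightarrow> 'r groupoid_gerbe \<Rightarrow>
    ('u, 'r) twisted_bundle \<Rightarrow> ('u, 'r) twisted_bundle \<Rightarrow> ('u \<Rightarrow> complex mat) set" where
  "tvb_hom G \<L> E F = {T \<in> extensional (pts (gobj G)).
     bundle_map (gobj G) (tvb_bundle E) (tvb_bundle F) T \<and>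
     (\<forall>g\<in>pts (garr G).
        T (gsrc G g) * tvb_act E g =
        tvb_act F g * (1\<^sub>m (vb_rank (gg_L \<L>) g) \<otimes>\<^sub>k T (gtgt G g)))}"

definition tvb_sum ::
    "('u, 'r) twisted_bundle \<Rightarrow> ('u, 'r) twisted_bundle \<Rightarrow> ('u, 'r) twisted_bundle" where
  "tvb_sum E F = \<lparr>
     tvb_bundle = sum_bundle (tvb_bundle E) (tvb_bundle F),
     tvb_act = (\<lambda>g. tvb_act E g \<oplus>\<^sub>d tvb_act F g)\<rparr>"

definition tvb_zero :: "('u, 'r) groupoid \<Rightarrow> ('u, 'r) twisted_bundle" where
  "tvb_zero G = \<lparr>tvb_bundle = zero_bundle (gobj G), tvb_act = (\<lambda>_. 1\<^sub>m 0)\<rparr>"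


section \<open>The groupoid and the groupoid gerbe of a bundle gerbe\<close>

definition fibre_groupoid :: "'y manifold \<Rightarrow> 'm manifold \<Rightarrow> ('y \<Rightarrow> 'm) \<Rightarrow> ('y, 'y \<times> 'y) groupoid" where
  "fibre_groupoid Y M \<pi> = \<lparr>
     gobj = Y, garr = Y2 Y M \<pi>, gsrc = fst, gtgt = snd,
     gunit = (\<lambda>y. (y, y)), ginv = (\<lambda>(y1, y2). (y2, y1)),
     gcomp = (\<lambda>g h. (fst g, snd h))\<rparr>"

abbreviation bg_groupoid :: "('y, 'm) bundle_gerbe \<Rightarrow> ('y, 'y \<times> 'y) groupoid" where
  "bg_groupoid B \<equiv> fibre_groupoid (bg_Y B) (bg_M B) (bg_proj B)"

text \<open>
  The isomorphism \<open>i\<^sup>* L \<cong> L\<^sup>*\<close> at \<open>(y1,y2)\<close> is \<open>bg_dual\<close> at \<open>(y2,y1)\<close>. The trivialization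
  \<open>L\<^bsub>(y1,y2)\<^esub> \<otimes> L\<^bsub>(y2,y3)\<^esub> \<otimes> L\<^bsub>(y3,y1)\<^esub> \<rightarrow> \<complex>\<close> is the product followed by the pairing of
  \<open>L\<^bsub>(y1,y3)\<^esub>\<close> with \<open>L\<^bsub>(y3,y1)\<^esub>\<close>.
\<close>

definition assoc_gerbe :: "('y, 'm) bundle_gerbe \<Rightarrow> ('y \<times> 'y) groupoid_gerbe" where
  "assoc_gerbe B = \<lparr>
     gg_L = bg_L B,
     gg_inv = (\<lambda>(y1, y2). bg_dual B (y2, y1)),
     gg_triv = (\<lambda>((y1, y2), (_, y3)).
        ev_mat (bg_dual B (y3, y1)) *
          (bg_prod B (y1, y2, y3) \<otimes>\<^sub>k 1\<^sub>m (vb_rank (bg_L B) (y3, y1))))\<rparr>"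


section \<open>Categories and their equivalence\<close>

text \<open>
  Morphisms do not carry their source and target: the sets \<open>Hom a b\<close> may overlap, and functors
  take the source and target of a morphism as additional arguments. \<open>Cmp g f\<close> is \<open>g \<circ> f\<close>.
\<close>

record ('o, 'a) precategory =
  Ob :: "'o set"
  Hom :: "'o \<Rightarrow> 'o \<Rightarrow> 'a set"
  Idn :: "'o \<Rightarrow> 'a"
  Cmp :: "'a \<Rightarrow> 'a \<Rightarrow> 'a"

definition category :: "('o, 'a) precategory \<Rightarrow> bool" where
  "category C \<longleftrightarrow>
     (\<forall>a\<in>Ob C. Idn C a \<in> Hom C a a) \<and>
     (\<forall>a\<in>Ob C. \<forall>b\<in>Ob C. \<forall>c\<in>Ob C. \<forall>f\<in>Hom C a b. \<forall>g\<in>Hom C b c. Cmp C g f \<in> Hom C a c) \<and>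
     (\<forall>a\<in>Ob C. \<forall>b\<in>Ob C. \<forall>f\<in>Hom C a b. Cmp C f (Idn C a) = f \<and> Cmp C (Idn C b) f = f) \<and>
     (\<forall>a\<in>Ob C. \<forall>b\<in>Ob C. \<forall>c\<in>Ob C. \<forall>d\<in>Ob C. \<forall>f\<in>Hom C a b. \<forall>g\<in>Hom C b c. \<forall>h\<in>Hom C c d.
        Cmp C h (Cmp C g f) = Cmp C (Cmp C h g) f)"

definition iso_in :: "('o, 'a) precategory \<Rightarrow> 'o \<Rightarrow> 'o \<Rightarrow> 'a set" where
  "iso_in C a b = {f \<in> Hom C a b. \<exists>g\<in>Hom C b a. Cmp C g f = Idn C a \<and> Cmp C f g = Idn C b}"

definition is_functor :: "('o, 'a) precategory \<Rightarrow> ('p, 'b) precategory \<Rightarrow>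
    ('o \<Rightarrow> 'p) \<Rightarrow> ('o \<Rightarrow> 'o \<Rightarrow> 'a \<Rightarrow> 'b) \<Rightarrow> bool" where
  "is_functor C D Fo Fm \<longleftrightarrow>
     (\<forall>a\<in>Ob C. Fo a \<in> Ob D) \<and>
     (\<forall>a\<in>Ob C. \<forall>b\<in>Ob C. \<forall>f\<in>Hom C a b. Fm a b f \<in> Hom D (Fo a) (Fo b)) \<and>
     (\<forall>a\<in>Ob C. Fm a a (Idn C a) = Idn D (Fo a)) \<and>
     (\<forall>a\<in>Ob C. \<forall>b\<in>Ob C. \<forall>c\<in>Ob C. \<forall>f\<in>Hom C a b. \<forall>g\<in>Hom C b c.
        Fm a c (Cmp C g f) = Cmp D (Fm b c g) (Fm a b f))"

definition natural_iso :: "('o, 'a) precategory \<Rightarrow> ('p, 'b) precategory \<Rightarrow>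
    ('o \<Rightarrow> 'p) \<Rightarrow> ('o \<Rightarrow> 'o \<Rightarrow> 'a \<Rightarrow> 'b) \<Rightarrow> ('o \<Rightarrow> 'p) \<Rightarrow> ('o \<Rightarrow> 'o \<Rightarrow> 'a \<Rightarrow> 'b) \<Rightarrow> ('o \<Rightarrow> 'b) \<Rightarrow> bool" where
  "natural_iso C D Fo Fm Go Gm \<eta> \<longleftrightarrow>
     (\<forall>a\<in>Ob C. \<eta> a \<in> iso_in D (Fo a) (Go a)) \<and>
     (\<forall>a\<in>Ob C. \<forall>b\<in>Ob C. \<forall>f\<in>Hom C a b. Cmp D (\<eta> b) (Fm a b f) = Cmp D (Gm a b f) (\<eta> a))"

definition equivalent_categories :: "('o, 'a) precategory \<Rightarrow> ('p, 'b) precategory \<Rightarrow> bool" where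
  "equivalent_categories C D \<longleftrightarrow> category C \<and> category D \<and>
     (\<exists>Fo Fm Go Gm \<eta> \<epsilon>.
        is_functor C D Fo Fm \<and> is_functor D C Go Gm \<and>
        natural_iso C C (\<lambda>a. a) (\<lambda>a b f. f) (\<lambda>a. Go (Fo a)) (\<lambda>a b f. Gm (Fo a) (Fo b) (Fm a b f)) \<eta> \<and>
        natural_iso D D (\<lambda>a. Fo (Go a)) (\<lambda>a b f. Fm (Go a) (Go b) (Gm a b f)) (\<lambda>a. a) (\<lambda>a b f. f) \<epsilon>)"

definition bgm_category :: "('y, 'm) bundle_gerbe \<Rightarrow> ('y bg_module, 'y \<Rightarrow> complex mat) precategory" where
  "bgm_category B = \<lparr>
     Ob = {E. is_bg_module B E},
     Hom = bgm_hom B,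
     Idn = (\<lambda>E. \<lambda>y\<in>pts (bg_Y B). 1\<^sub>m (vb_rank (bgm_bundle E) y)),
     Cmp = (\<lambda>S T. \<lambda>y\<in>pts (bg_Y B). S y * T y)\<rparr>"

definition tvb_category :: "('u, 'r) groupoid \<Rightarrow> 'r groupoid_gerbe \<Rightarrow>
    (('u, 'r) twisted_bundle, 'u \<Rightarrow> complex mat) precategory" where
  "tvb_category G \<L> = \<lparr>
     Ob = {E. is_twisted_bundle G \<L> E},
     Hom = tvb_hom G \<L>,
     Idn = (\<lambda>E. \<lambda>u\<in>pts (gobj G). 1\<^sub>m (vb_rank (tvb_bundle E) u)),
     Cmp = (\<lambda>S T. \<lambda>u\<in>pts (gobj G). S u * T u)\<rparr>"


section \<open>Grothendieck groups\<close>

definition iso_class :: "('o, 'a) precategory \<Rightarrow> 'o \<Rightarrow> 'o set" where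
  "iso_class C a = {b \<in> Ob C. iso_in C a b \<noteq> {}}"

definition iso_class_monoid ::
    "('o, 'a) precategory \<Rightarrow> ('o \<Rightarrow> 'o \<Rightarrow> 'o) \<Rightarrow> 'o \<Rightarrow> 'o set monoid" where
  "iso_class_monoid C pl z = \<lparr>
     carrier = iso_class C ` Ob C,
     mult = (\<lambda>P Q. \<Union>a\<in>P. \<Union>b\<in>Q. iso_class C (pl a b)),
     one = iso_class C z\<rparr>"

definition groth_rel :: "'s monoid \<Rightarrow> (('s \<times> 's) \<times> ('s \<times> 's)) set" where
  "groth_rel S = {((a, b), (c, d)). a \<in> carrier S \<and> b \<in> carrier S \<and> c \<in> carrier S \<and> d \<in> carrier S \<and>
     (\<exists>k\<in>carrier S. a \<otimes>\<^bsub>S\<^esub> d \<otimes>\<^bsub>S\<^esub> k = c \<otimes>\<^bsub>S\<^esub> b \<otimes>\<^bsub>S\<^esub> k)}"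

definition grothendieck :: "'s monoid \<Rightarrow> ('s \<times> 's) set monoid" where
  "grothendieck S = \<lparr>
     carrier = (carrier S \<times> carrier S) // groth_rel S,
     mult = (\<lambda>P Q. \<Union>(a, b)\<in>P. \<Union>(c, d)\<in>Q. groth_rel S `` {(a \<otimes>\<^bsub>S\<^esub> c, b \<otimes>\<^bsub>S\<^esub> d)}),
     one = groth_rel S `` {(\<one>\<^bsub>S\<^esub>, \<one>\<^bsub>S\<^esub>)}\<rparr>"

definition K_bg :: "('y, 'm) bundle_gerbe \<Rightarrow> ('y bg_module set \<times> 'y bg_module set) set monoid" where
  "K_bg B = grothendieck (iso_class_monoid (bgm_category B) bgm_sum (bgm_zero B))"

definition K_gpd :: "('u, 'r) groupoid \<Rightarrow> 'r groupoid_gerbe \<Rightarrow>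
    (('u, 'r) twisted_bundle set \<times> ('u, 'r) twisted_bundle set) set monoid" where
  "K_gpd G \<L> = grothendieck (iso_class_monoid (tvb_category G \<L>) tvb_sum (tvb_zero G))"

end

theory Submission
  imports Defs
begin

text \<open>
  The two categories have the same data, except that a bundle gerbe module carries a hermitian metric,
  which morphisms are not asked to respect. Over \<open>\<G>(Y, M)\<close> a composable pair of arrows is a point
  \<open>((y1, y2), (y2, y3))\<close> of \<open>Y\<^sup>[\<^sup>3\<^sup>]\<close>, and the product of the associated gerbe, although recovered from a
  trivialization of a threefold tensor product, is the product of the bundle gerbe
  (\<open>gg_prod_assoc_gerbe\<close>): the pairing of \<open>L\<^bsub>(y1,y3)\<^esub>\<close> with \<open>L\<^bsub>(y3,y1)\<^esub>\<close> is an invertible \<open>1 \<times> 1\<close> matrix and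
  can be cancelled. So forgetting the metric turns modules into twisted bundles and changes neither
  the morphism sets nor their composition.

  The analytic content is that every twisted bundle arises in this way, that is, that every vector
  bundle over a manifold has a hermitian metric (\<open>hermitian_metric_exists\<close>). The metric is glued from
  flat metrics of local trivializations by means of a locally finite family of bump functions
  (\<open>locally_finite_bump_family\<close>). These functions rest on the smoothness of \<open>exp (- 1/t)\<close> at \<open>0\<close>, on the
  compactness of cubes in charts, and on the Lindelof property of second countable spaces. The other use of
  analysis is that bundle maps compose (\<open>bundle_map_compose\<close>), which makes the twisted bundles a
  category.

  The rest is formal (locale \<open>forgetful\<close>): a map of objects that is onto and through which the morphism
  sets, identities and composition of one category are defined from those of another is part of an
  equivalence. Its preimage map identifies isomorphism classes with isomorphism classes and commutes with
  the sum, so that it induces an isomorphism of Grothendieck groups (\<open>grothendieck_iso\<close>).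
\<close>

section \<open>Calculus of smooth functions on open subsets of Euclidean space\<close>

lemma openin_Euclidean_space_vary:
  assumes "openin (Euclidean_space n) S" "x \<in> S" "i < n"
  shows "eventually (\<lambda>t. x(i := t) \<in> S) (nhds (x i))"
proof -
  have "continuous_map euclideanreal (Euclidean_space n) (\<lambda>t. x(i := t))"
    using openin_subset[OF assms(1)] assms(2,3)
    by (auto simp: Euclidean_space_def continuous_map_in_subtopology continuous_map_componentwise_UNIV
        topspace_Euclidean_space)
  from openin_continuous_map_preimage[OF this assms(1)]
  have "open {t. x(i := t) \<in> S}" by simp
  then show ?thesis
    using assms(2) by (auto simp: eventually_nhds intro!: exI[of _ "{t. x(i := t) \<in> S}"])
qed

lemma openin_Euclidean_space_vary_cong:
  assumes S: "openin (Euclidean_space n) S" "x \<in> S" "i < n"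
    and eq: "\<And>x. x \<in> S \<Longrightarrow> f x = f' x"
    and der: "((\<lambda>t. f (x(i := t))) has_vector_derivative d) (at (x i))"
  shows "((\<lambda>t. f' (x(i := t))) has_vector_derivative d) (at (x i))"
proof -
  have "eventually (\<lambda>t. f (x(i := t)) = f' (x(i := t))) (nhds (x i))"
    using openin_Euclidean_space_vary[OF S] by eventually_elim (auto intro: eq)
  with der show ?thesis
    by (subst has_vector_derivative_cong_ev[symmetric, where f = "\<lambda>t. f (x(i := t))"])
      (auto simp: S(2) eq eventually_mono)
qed

lemma Ck_on_continuous:
  "Ck_on n k S f \<Longrightarrow> continuous_map (subtopology (Euclidean_space n) S) euclidean f"
  by (cases k) auto

lemma Ck_on_SucE:
  assumes "Ck_on n (Suc k) S f" "i < n"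
  obtains f' where "\<And>x. x \<in> S \<Longrightarrow> ((\<lambda>t. f (x(i := t))) has_vector_derivative f' x) (at (x i))"
    "Ck_on n k S f'"
  using assms unfolding Ck_on.simps by meson

lemma Ck_on_SucI:
  assumes "continuous_map (subtopology (Euclidean_space n) S) euclidean f"
    and "\<And>i. i < n \<Longrightarrow> \<exists>g. (\<forall>x\<in>S. ((\<lambda>t. f (x(i := t))) has_vector_derivative g x) (at (x i))) \<and> Ck_on n k S g"
  shows "Ck_on n (Suc k) S f"
  using assms unfolding Ck_on.simps by meson

lemma Ck_on_cong:
  assumes "openin (Euclidean_space n) S" "\<And>x. x \<in> S \<Longrightarrow> f x = f' x" "Ck_on n k S f"
  shows "Ck_on n k S f'"
proof -
  have "continuous_map (subtopology (Euclidean_space n) S) euclidean f'"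
    using Ck_on_continuous[OF assms(3)] by (rule continuous_map_eq) (use assms(2) in auto)
  then show ?thesis
  proof (cases k)
    case (Suc m)
    show ?thesis unfolding Suc
    proof (rule Ck_on_SucI)
      fix i assume "i < n"
      with assms(3) obtain g where "\<And>x. x \<in> S \<Longrightarrow> ((\<lambda>t. f (x(i := t))) has_vector_derivative g x) (at (x i))"
        "Ck_on n m S g"
        unfolding Suc by (metis Ck_on_SucE)
      moreover have "((\<lambda>t. f' (x(i := t))) has_vector_derivative g x) (at (x i))" if "x \<in> S" for x
        using openin_Euclidean_space_vary_cong[of n S x i f f', OF assms(1) that \<open>i < n\<close>]
          assms(2) calculation(1)[OF that] by blast
      ultimately show "\<exists>g. (\<forall>x\<in>S. ((\<lambda>t. f' (x(i := t))) has_vector_derivative g x) (at (x i))) \<and> Ck_on n m S g"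
        by (intro exI[of _ g] conjI ballI)
    qed fact
  qed simp
qed

lemma Ck_on_subset: "Ck_on n k S f \<Longrightarrow> T \<subseteq> S \<Longrightarrow> Ck_on n k T f"
proof (induction k arbitrary: f)
  case 0
  then show ?case by (auto intro: continuous_map_from_subtopology_mono)
next
  case (Suc k)
  then have "continuous_map (subtopology (Euclidean_space n) T) euclidean f"
    by (auto intro: continuous_map_from_subtopology_mono)
  then show ?case
    by (rule Ck_on_SucI) (metis Suc.IH Suc.prems Ck_on_SucE subsetD)
qed

lemma Ck_on_Suc_imp: "Ck_on n (Suc k) S f \<Longrightarrow> Ck_on n k S f"
proof (induction k arbitrary: f)
  case 0
  then show ?case by simp
next
  case (Suc k)
  from Suc.prems have "continuous_map (subtopology (Euclidean_space n) S) euclidean f"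
    by (rule Ck_on_continuous)
  then show ?case
    by (rule Ck_on_SucI) (metis Suc.IH Suc.prems Ck_on_SucE)
qed

text \<open>The partial derivatives found on the members of an open cover agree on overlaps, because
  derivatives are unique.\<close>

lemma Ck_on_local:
  assumes "openin (Euclidean_space n) S"
    and "\<And>x. x \<in> S \<Longrightarrow> \<exists>V. x \<in> V \<and> openin (Euclidean_space n) V \<and> Ck_on n k V f"
  shows "Ck_on n k S f"
proof -
  have main: "Ck_on n k S f"
    if "\<And>x. x \<in> S \<Longrightarrow> \<exists>V. x \<in> V \<and> V \<subseteq> S \<and> openin (Euclidean_space n) V \<and> Ck_on n k V f" for f
    using that
  proof (induction k arbitrary: f)
    case (0 f)
    then obtain V where V: "\<And>x. x \<in> S \<Longrightarrow> x \<in> V x \<and> V x \<subseteq> S \<and> openin (Euclidean_space n) (V x) \<and>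
        continuous_map (subtopology (Euclidean_space n) (V x)) euclidean f"
      by simp metis
    have "continuous_map (subtopology (Euclidean_space n) S) euclidean f"
    proof (rule pasting_lemma[where I = S and T = V and f = "\<lambda>_. f"])
      show "openin (subtopology (Euclidean_space n) S) (V i)" if "i \<in> S" for i
        using V[OF that] assms(1) by (simp add: openin_open_subtopology)
      show "continuous_map (subtopology (subtopology (Euclidean_space n) S) (V i)) euclidean f"
        if "i \<in> S" for i
        using V[OF that] by (simp add: subtopology_subtopology inf.absorb2)
    qed (use V in auto)
    then show ?case by simp
  next
    case (Suc k)
    have "Ck_on n k S f"
      by (rule Suc.IH) (meson Suc.prems Ck_on_Suc_imp)
    then have cont: "continuous_map (subtopology (Euclidean_space n) S) euclidean f"
      by (rule Ck_on_continuous)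
    have "\<exists>g. (\<forall>x\<in>S. ((\<lambda>t. f (x(i := t))) has_vector_derivative g x) (at (x i))) \<and> Ck_on n k S g"
      if i: "i < n" for i
    proof -
      \<comment> \<open>A global choice of the derivative, which does not depend on the member of the cover.\<close>
      define g where "g x = vector_derivative (\<lambda>t. f (x(i := t))) (at (x i))" for x
      have loc: "\<exists>V. x \<in> V \<and> V \<subseteq> S \<and> openin (Euclidean_space n) V \<and> Ck_on n k V g \<and>
          ((\<lambda>t. f (x(i := t))) has_vector_derivative g x) (at (x i))" if "x \<in> S" for x
      proof -
        from Suc.prems[OF that] obtain V where V: "x \<in> V" "V \<subseteq> S" "openin (Euclidean_space n) V"
          "Ck_on n (Suc k) V f"
          by blast
        from V(4) i obtain g' where g':
          "\<And>x. x \<in> V \<Longrightarrow> ((\<lambda>t. f (x(i := t))) has_vector_derivative g' x) (at (x i))" "Ck_on n k V g'"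
          by (metis Ck_on_SucE)
        have eq: "g' y = g y" if "y \<in> V" for y
          using vector_derivative_at[OF g'(1)[OF that]] by (simp add: g_def)
        show ?thesis
          using V g' Ck_on_cong[OF V(3) eq g'(2)] eq by metis
      qed
      show ?thesis
        by (rule exI[of _ g]) (use loc Suc.IH[of g] in blast)
    qed
    with cont show ?case by (rule Ck_on_SucI)
  qed
  show ?thesis
  proof (rule main)
    fix x assume "x \<in> S"
    with assms(2) obtain V where "x \<in> V" "openin (Euclidean_space n) V" "Ck_on n k V f" by blast
    then show "\<exists>V. x \<in> V \<and> V \<subseteq> S \<and> openin (Euclidean_space n) V \<and> Ck_on n k V f"
      using \<open>x \<in> S\<close> assms(1) by (intro exI[of _ "V \<inter> S"]) (auto intro: Ck_on_subset)
  qed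
qed

lemma Ck_on_const: "Ck_on n k S (\<lambda>_. c)"
  by (induction k arbitrary: c) (auto intro!: exI[of _ "\<lambda>_. 0"])

lemma Ck_on_add:
  fixes f g :: "(nat \<Rightarrow> real) \<Rightarrow> 'b::real_normed_vector"
  shows "Ck_on n k S f \<Longrightarrow> Ck_on n k S g \<Longrightarrow> Ck_on n k S (\<lambda>x. f x + g x)"
proof (induction k arbitrary: f g)
  case 0
  then show ?case by (auto intro: continuous_map_add)
next
  case (Suc k)
  have "\<exists>h. (\<forall>x\<in>S. ((\<lambda>t. f (x(i := t)) + g (x(i := t))) has_vector_derivative h x) (at (x i))) \<and> Ck_on n k S h"
    if i: "i < n" for i
  proof -
    from Suc.prems(1) i obtain f' where
      f': "\<And>x. x \<in> S \<Longrightarrow> ((\<lambda>t. f (x(i := t))) has_vector_derivative f' x) (at (x i))" "Ck_on n k S f'"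
      by (metis Ck_on_SucE)
    from Suc.prems(2) i obtain g' where
      g': "\<And>x. x \<in> S \<Longrightarrow> ((\<lambda>t. g (x(i := t))) has_vector_derivative g' x) (at (x i))" "Ck_on n k S g'"
      by (metis Ck_on_SucE)
    from f' g' show ?thesis
      by (intro exI[of _ "\<lambda>x. f' x + g' x"]) (auto intro!: Suc.IH has_vector_derivative_add)
  qed
  moreover have "continuous_map (subtopology (Euclidean_space n) S) euclidean (\<lambda>x. f x + g x)"
    using Suc.prems Ck_on_continuous continuous_map_add by blast
  ultimately show ?case by (intro Ck_on_SucI)
qed

lemma Ck_on_mult:
  fixes f g :: "(nat \<Rightarrow> real) \<Rightarrow> 'b::real_normed_algebra"
  shows "Ck_on n k S f \<Longrightarrow> Ck_on n k S g \<Longrightarrow> Ck_on n k S (\<lambda>x. f x * g x)"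
proof (induction k arbitrary: f g)
  case 0
  then show ?case
    by (auto simp: continuous_map_atin intro: tendsto_mult)
next
  case (Suc k)
  have k: "Ck_on n k S f" "Ck_on n k S g"
    using Suc.prems Ck_on_Suc_imp by blast+
  have "\<exists>h. (\<forall>x\<in>S. ((\<lambda>t. f (x(i := t)) * g (x(i := t))) has_vector_derivative h x) (at (x i))) \<and> Ck_on n k S h"
    if i: "i < n" for i
  proof -
    from Suc.prems(1) i obtain f' where
      f': "\<And>x. x \<in> S \<Longrightarrow> ((\<lambda>t. f (x(i := t))) has_vector_derivative f' x) (at (x i))" "Ck_on n k S f'"
      by (metis Ck_on_SucE)
    from Suc.prems(2) i obtain g' where
      g': "\<And>x. x \<in> S \<Longrightarrow> ((\<lambda>t. g (x(i := t))) has_vector_derivative g' x) (at (x i))" "Ck_on n k S g'"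
      by (metis Ck_on_SucE)
    have "((\<lambda>t. f (x(i := t)) * g (x(i := t))) has_vector_derivative f x * g' x + f' x * g x) (at (x i))"
      if "x \<in> S" for x
      using has_vector_derivative_mult[OF f'(1)[OF that] g'(1)[OF that]] by simp
    moreover have "Ck_on n k S (\<lambda>x. f x * g' x + f' x * g x)"
      by (intro Ck_on_add Suc.IH k f' g')
    ultimately show ?thesis by (intro exI[of _ "\<lambda>x. f x * g' x + f' x * g x"] conjI ballI)
  qed
  moreover have cont: "continuous_map (subtopology (Euclidean_space n) S) euclidean (\<lambda>x. f x * g x)"
    using Suc.IH[OF k] Ck_on_continuous by blast
  ultimately show ?case by (intro Ck_on_SucI)
qed

lemma Ck_on_bounded_linear:
  assumes F: "bounded_linear F"
  shows "Ck_on n k S f \<Longrightarrow> Ck_on n k S (\<lambda>x. F (f x))"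
proof (induction k arbitrary: f)
  case 0
  then show ?case
    by (auto simp: continuous_map_atin intro: bounded_linear.tendsto[OF F])
next
  case (Suc k)
  have "\<exists>h. (\<forall>x\<in>S. ((\<lambda>t. F (f (x(i := t)))) has_vector_derivative h x) (at (x i))) \<and> Ck_on n k S h"
    if i: "i < n" for i
  proof -
    from Suc.prems i obtain f' where
      "\<And>x. x \<in> S \<Longrightarrow> ((\<lambda>t. f (x(i := t))) has_vector_derivative f' x) (at (x i))" "Ck_on n k S f'"
      by (metis Ck_on_SucE)
    then show ?thesis
      by (intro exI[of _ "\<lambda>x. F (f' x)"])
        (auto intro!: Suc.IH bounded_linear.has_vector_derivative[OF F])
  qed
  moreover have "continuous_map (subtopology (Euclidean_space n) S) euclidean (\<lambda>x. F (f x))"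
    using Suc.IH[OF Ck_on_Suc_imp[OF Suc.prems]] Ck_on_continuous by blast
  ultimately show ?case by (intro Ck_on_SucI)
qed


section \<open>Flat functions\<close>

text \<open>
  The smooth function that is \<open>exp (- 1/t)\<close> for \<open>t > 0\<close> and vanishes for \<open>t \<le> 0\<close> is the building
  block of all cut-offs below. Its derivatives are of the form \<open>p (1/t) exp (- 1/t)\<close>, and this class
  of functions, indexed by the polynomial \<open>p\<close>, is closed under differentiation.
\<close>

definition flat :: "real poly \<Rightarrow> real \<Rightarrow> real" where
  "flat p t = (if t > 0 then poly p (1 / t) * exp (- (1 / t)) else 0)"

lemma poly_times_exp_minus_tendsto_0:
  fixes p :: "real poly"
  shows "((\<lambda>s. poly p s * exp (- s)) \<longlongrightarrow> 0) at_top"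
proof -
  have "((\<lambda>s. \<Sum>i\<le>degree p. coeff p i * (s ^ i / exp s)) \<longlongrightarrow> (\<Sum>i\<le>degree p. coeff p i * 0)) at_top"
    by (intro tendsto_intros tendsto_power_div_exp_0)
  then show ?thesis
    by (simp add: poly_altdef sum_distrib_right exp_minus divide_inverse mult.assoc)
qed

lemma flat_tendsto_0: "(flat p \<longlongrightarrow> 0) (at 0)"
proof (rule filterlim_split_at)
  have "((\<lambda>t. poly p (inverse t) * exp (- inverse t)) \<longlongrightarrow> 0) (at_right 0)"
    using poly_times_exp_minus_tendsto_0 filterlim_inverse_at_top_right by (rule filterlim_compose)
  then show "(flat p \<longlongrightarrow> 0) (at_right 0)"
    by (rule Lim_transform_eventually)
      (auto simp: flat_def eventually_at_right_field divide_inverse intro: exI[of _ 1])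
  show "(flat p \<longlongrightarrow> 0) (at_left 0)"
    by (rule Lim_transform_eventually[OF tendsto_const])
      (auto simp: flat_def eventually_at_left_field intro: exI[of _ "-1"])
qed

lemma flat_has_derivative:
  "(flat p has_real_derivative flat (monom 1 2 * (p - pderiv p)) t) (at t)"
proof (cases t "0 :: real" rule: linorder_cases)
  case less
  have "((\<lambda>_. 0) has_real_derivative 0) (at t)" by simp
  then have "(flat p has_real_derivative 0) (at t)"
    by (rule has_field_derivative_transform_within_open[where S = "{..<0}"])
      (use less in \<open>auto simp: flat_def\<close>)
  with less show ?thesis by (simp add: flat_def)
next
  case equal
  \<comment> \<open>The difference quotient at \<open>0\<close> is \<open>flat\<close> of the polynomial \<open>X p\<close>.\<close>
  have "(flat p has_real_derivative 0) (at 0)"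
    unfolding DERIV_def
    by (rule Lim_transform_eventually[OF flat_tendsto_0[of "monom 1 1 * p"]])
      (auto simp: flat_def poly_monom field_simps intro!: eventuallyI)
  with equal show ?thesis by (simp add: flat_def)
next
  case greater
  have "((\<lambda>t. poly p (1 / t) * exp (- (1 / t))) has_real_derivative
      flat (monom 1 2 * (p - pderiv p)) t) (at t)"
    using greater
    by (auto intro!: derivative_eq_intros DERIV_chain2[where f = "poly p"] poly_DERIV
        simp: flat_def poly_monom field_simps power2_eq_square)
  then show ?thesis
    by (rule has_field_derivative_transform_within_open[where S = "{0<..}"])
      (use greater in \<open>auto simp: flat_def\<close>)
qed

text \<open>All polynomials are treated at once, as differentiation changes the polynomial.\<close>

lemma Ck_on_flat: "Ck_on n k S g \<Longrightarrow> Ck_on n k S (\<lambda>x. flat p (g x))"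
proof (induction k arbitrary: p)
  case 0
  then show ?case
    by (auto simp: continuous_map_atin intro: isCont_tendsto_compose[OF DERIV_isCont[OF flat_has_derivative]])
next
  case (Suc k)
  have k: "Ck_on n k S g"
    using Suc.prems by (rule Ck_on_Suc_imp)
  show ?case
  proof (rule Ck_on_SucI)
    show "continuous_map (subtopology (Euclidean_space n) S) euclidean (\<lambda>x. flat p (g x))"
      using Suc.IH[OF k] by (rule Ck_on_continuous)
    fix i assume "i < n"
    with Suc.prems obtain g' where
      g': "\<And>x. x \<in> S \<Longrightarrow> ((\<lambda>t. g (x(i := t))) has_vector_derivative g' x) (at (x i))" "Ck_on n k S g'"
      by (metis Ck_on_SucE)
    let ?p' = "monom 1 2 * (p - pderiv p)"
    have "((\<lambda>t. flat p (g (x(i := t)))) has_vector_derivative flat ?p' (g x) * g' x) (at (x i))"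
      if "x \<in> S" for x
    proof -
      have "((\<lambda>t. g (x(i := t))) has_real_derivative g' x) (at (x i))"
        using g'(1)[OF that] by (simp only: has_real_derivative_iff_has_vector_derivative)
      from DERIV_chain2[OF flat_has_derivative this, of p] show ?thesis
        by (simp only: has_real_derivative_iff_has_vector_derivative fun_upd_triv)
    qed
    moreover have "Ck_on n k S (\<lambda>x. flat ?p' (g x) * g' x)"
      by (intro Ck_on_mult Suc.IH k g')
    ultimately show "\<exists>h. (\<forall>x\<in>S. ((\<lambda>t. flat p (g (x(i := t)))) has_vector_derivative h x) (at (x i))) \<and> Ck_on n k S h"
      by (intro exI[of _ "\<lambda>x. flat ?p' (g x) * g' x"] conjI ballI)
  qed
qed

section \<open>Smooth functions on manifolds\<close>

lemma chart_openin_image: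
  assumes "smooth_manifold X" "(U, \<phi>) \<in> matlas X" "openin (mtop X) W"
  shows "openin (Euclidean_space (mdim X)) (\<phi> ` (U \<inter> W))"
proof -
  have U: "openin (mtop X) U" "openin (Euclidean_space (mdim X)) (\<phi> ` U)"
    and h: "homeomorphic_map (subtopology (mtop X) U) (subtopology (Euclidean_space (mdim X)) (\<phi> ` U)) \<phi>"
    using assms(1,2) by (auto simp: smooth_manifold_def is_chart_def)
  have "openin (subtopology (mtop X) U) (U \<inter> W)"
    using U assms(3) by (simp add: openin_open_subtopology openin_Int)
  then have "openin (subtopology (Euclidean_space (mdim X)) (\<phi> ` U)) (\<phi> ` (U \<inter> W))"
    using homeomorphic_map_openness_eq[OF h] by blast
  then show ?thesis
    using U(2) by (simp add: openin_open_subtopology)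
qed

lemma chart_inj_on:
  assumes "smooth_manifold X" "(U, \<phi>) \<in> matlas X"
  shows "inj_on \<phi> U"
proof -
  have "openin (mtop X) U"
    and "homeomorphic_map (subtopology (mtop X) U) (subtopology (Euclidean_space (mdim X)) (\<phi> ` U)) \<phi>"
    using assms by (auto simp: smooth_manifold_def is_chart_def)
  then show ?thesis
    using homeomorphic_imp_injective_map openin_subset by (fastforce simp: inf.absorb2)
qed

lemma smooth_fun_openin: "smooth_fun X W f \<Longrightarrow> openin (mtop X) W"
  by (simp add: smooth_fun_def)

lemma smooth_funI:
  assumes "openin (mtop X) W"
    and "\<And>U \<phi> k. (U, \<phi>) \<in> matlas X \<Longrightarrow> Ck_on (mdim X) k (\<phi> ` (U \<inter> W)) (\<lambda>p. f (inv_into U \<phi> p))"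
  shows "smooth_fun X W f"
  using assms by (auto simp: smooth_fun_def Cinf_on_def)

lemma smooth_funD:
  assumes "smooth_fun X W f" "(U, \<phi>) \<in> matlas X"
  shows "Ck_on (mdim X) k (\<phi> ` (U \<inter> W)) (\<lambda>p. f (inv_into U \<phi> p))"
  using assms by (auto simp: smooth_fun_def Cinf_on_def)

lemma smooth_fun_const: "openin (mtop X) W \<Longrightarrow> smooth_fun X W (\<lambda>_. c)"
  by (rule smooth_funI) (auto intro: Ck_on_const)

lemma smooth_fun_add:
  assumes "smooth_fun X W f" "smooth_fun X W g"
  shows "smooth_fun X W (\<lambda>x. f x + g x)"
  by (rule smooth_funI[OF smooth_fun_openin[OF assms(1)]]) (intro Ck_on_add smooth_funD[OF assms(1)] smooth_funD[OF assms(2)])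

lemma smooth_fun_mult:
  assumes "smooth_fun X W f" "smooth_fun X W g"
  shows "smooth_fun X W (\<lambda>x. f x * g x)"
  by (rule smooth_funI[OF smooth_fun_openin[OF assms(1)]]) (intro Ck_on_mult smooth_funD[OF assms(1)] smooth_funD[OF assms(2)])

lemma smooth_fun_cnj:
  assumes "smooth_fun X W f"
  shows "smooth_fun X W (\<lambda>x. cnj (f x))"
  by (rule smooth_funI[OF smooth_fun_openin[OF assms]])
    (rule Ck_on_bounded_linear[OF bounded_linear_cnj smooth_funD[OF assms]])

text \<open>Smooth functions on a manifold are complex valued; the real part gives back the inner function
  to which \<open>Ck_on_flat\<close> applies.\<close>

lemma smooth_fun_flat:
  assumes "smooth_fun X W (\<lambda>x. of_real (g x))"
  shows "smooth_fun X W (\<lambda>x. of_real (flat p (g x)))"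
proof -
  have "Ck_on n k S (\<lambda>q. of_real (flat p (h q)) :: complex)"
    if "Ck_on n k S (\<lambda>q. of_real (h q) :: complex)" for n k S h
    using Ck_on_bounded_linear[OF bounded_linear_of_real
        Ck_on_flat[OF Ck_on_bounded_linear[OF bounded_linear_Re that]]]
    by simp
  from this[OF smooth_funD[OF assms]] show ?thesis
    by (intro smooth_funI smooth_fun_openin[OF assms])
qed

lemma smooth_fun_sum:
  assumes "finite I" "openin (mtop X) W" "\<And>i. i \<in> I \<Longrightarrow> smooth_fun X W (f i)"
  shows "smooth_fun X W (\<lambda>x. \<Sum>i\<in>I. f i x)"
  using assms by (induction I) (auto intro: smooth_fun_const smooth_fun_add)

lemma smooth_fun_prod:
  assumes "finite I" "openin (mtop X) W" "\<And>i. i \<in> I \<Longrightarrow> smooth_fun X W (f i)"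
  shows "smooth_fun X W (\<lambda>x. \<Prod>i\<in>I. f i x)"
  using assms by (induction I) (auto intro: smooth_fun_const smooth_fun_mult)

lemma smooth_fun_subset:
  assumes "smooth_fun X W f" "openin (mtop X) V" "V \<subseteq> W"
  shows "smooth_fun X V f"
  by (rule smooth_funI[OF assms(2)], rule Ck_on_subset[OF smooth_funD[OF assms(1)]])
    (use assms(3) in auto)

lemma smooth_fun_local:
  assumes X: "smooth_manifold X" and W: "openin (mtop X) W"
    and loc: "\<And>x. x \<in> W \<Longrightarrow> \<exists>V. x \<in> V \<and> smooth_fun X V f"
  shows "smooth_fun X W f"
  unfolding smooth_fun_def
proof (intro conjI W ballI, clarify)
  fix U \<phi> assume U: "(U, \<phi>) \<in> matlas X"
  show "Cinf_on (mdim X) (\<phi> ` (U \<inter> W)) (\<lambda>p. f (inv_into U \<phi> p))"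
    unfolding Cinf_on_def
  proof (intro allI Ck_on_local chart_openin_image[OF X U W])
    fix k p assume "p \<in> \<phi> ` (U \<inter> W)"
    then obtain x where x: "x \<in> U" "x \<in> W" "p = \<phi> x" by blast
    with loc obtain V where V: "x \<in> V" "smooth_fun X V f" by blast
    then show "\<exists>V. p \<in> V \<and> openin (Euclidean_space (mdim X)) V \<and> Ck_on (mdim X) k V (\<lambda>p. f (inv_into U \<phi> p))"
      using U x chart_openin_image[OF X U smooth_fun_openin[OF V(2)]]
      by (intro exI[of _ "\<phi> ` (U \<inter> V)"]) (auto simp: smooth_fun_def Cinf_on_def)
  qed
qed

lemma smooth_fun_cong:
  assumes X: "smooth_manifold X" and f: "smooth_fun X W f" and eq: "\<And>x. x \<in> W \<Longrightarrow> f x = g x"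
  shows "smooth_fun X W g"
  unfolding smooth_fun_def
proof (intro conjI smooth_fun_openin[OF f] ballI, clarify)
  fix U \<phi> assume U: "(U, \<phi>) \<in> matlas X"
  show "Cinf_on (mdim X) (\<phi> ` (U \<inter> W)) (\<lambda>p. g (inv_into U \<phi> p))"
    unfolding Cinf_on_def
  proof (intro allI)
    fix k
    have "Ck_on (mdim X) k (\<phi> ` (U \<inter> W)) (\<lambda>p. f (inv_into U \<phi> p))"
      using f U by (auto simp: smooth_fun_def Cinf_on_def)
    then show "Ck_on (mdim X) k (\<phi> ` (U \<inter> W)) (\<lambda>p. g (inv_into U \<phi> p))"
      by (rule Ck_on_cong[OF chart_openin_image[OF X U smooth_fun_openin[OF f]], rotated])
        (use eq chart_inj_on[OF X U] in auto)
  qed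
qed

text \<open>Extension by zero: \<open>W\<close> is covered by the open sets \<open>W \<inter> U\<close> and \<open>W - K\<close>.\<close>

lemma smooth_fun_extend_zero:
  assumes X: "smooth_manifold X" and f: "smooth_fun X (W \<inter> U) f" and W: "openin (mtop X) W"
    and K: "closedin (mtop X) K" "K \<subseteq> U" and zero: "\<And>x. x \<in> W - K \<Longrightarrow> f x = 0"
  shows "smooth_fun X W f"
proof (rule smooth_fun_local[OF X W])
  fix x assume x: "x \<in> W"
  have "smooth_fun X (W - K) f"
    by (rule smooth_fun_cong[OF X smooth_fun_const[of _ _ 0]]) (use W K zero in \<open>auto intro: openin_diff\<close>)
  with f K x show "\<exists>V. x \<in> V \<and> smooth_fun X V f"
    by (cases "x \<in> K") blast+
qed

lemma smooth_fun_chart_coordinate: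
  assumes X: "smooth_manifold X" and U: "(U, \<phi>) \<in> matlas X" and j: "j < mdim X"
  shows "smooth_fun X U (\<lambda>x. of_real (\<phi> x j))"
  unfolding smooth_fun_def
proof (intro conjI ballI)
  show "openin (mtop X) U"
    using X U by (auto simp: smooth_manifold_def is_chart_def)
  fix c assume "c \<in> matlas X"
  moreover obtain V \<psi> where "c = (V, \<psi>)" by fastforce
  ultimately have "smooth_transition (mdim X) (V, \<psi>) (U, \<phi>)"
    using X U by (auto simp: smooth_manifold_def)
  then show "case c of (V, \<psi>) \<Rightarrow>
      Cinf_on (mdim X) (\<psi> ` (V \<inter> U)) (\<lambda>p. of_real (\<phi> (inv_into V \<psi> p) j))"
    using j \<open>c = (V, \<psi>)\<close>
    by (auto simp: smooth_transition_def Cinf_on_def intro: Ck_on_bounded_linear[OF bounded_linear_of_real])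
qed


section \<open>Bump functions and locally finite families\<close>

lemma flat_1_nonneg: "flat 1 t \<ge> 0" and flat_1_pos_iff: "flat 1 t > 0 \<longleftrightarrow> t > 0"
  by (auto simp: flat_def)

lemma openin_Euclidean_space_cube:
  assumes O: "openin (Euclidean_space n) S" and c: "c \<in> S"
  obtains e where "e > 0" "\<And>x. x \<in> topspace (Euclidean_space n) \<Longrightarrow> (\<And>i. i < n \<Longrightarrow> \<bar>x i - c i\<bar> \<le> e) \<Longrightarrow> x \<in> S"
proof -
  from O obtain T where T: "openin (powertop_real UNIV) T" "S = T \<inter> {x. \<forall>i\<ge>n. x i = 0}"
    by (auto simp: Euclidean_space_def openin_subtopology)
  with c obtain B where B: "finite {i. B i \<noteq> UNIV}" "\<And>i. open (B i)" "c \<in> Pi\<^sub>E UNIV B" "Pi\<^sub>E UNIV B \<subseteq> T"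
    by (auto simp: openin_product_topology_alt)
  have "\<exists>e>0. \<forall>t. \<bar>t - c i\<bar> \<le> e \<longrightarrow> t \<in> B i" for i
  proof -
    have "c i \<in> B i" using B(3) by auto
    with B(2)[of i] obtain e where "e > 0" "cball (c i) e \<subseteq> B i"
      using open_contains_cball by metis
    then show ?thesis by (auto simp: dist_real_def abs_minus_commute subset_iff)
  qed
  then obtain e where e: "\<And>i. e i > 0" "\<And>i t. \<bar>t - c i\<bar> \<le> e i \<Longrightarrow> t \<in> B i" by metis
  define d where "d = Min (insert 1 (e ` {..<n}))"
  have d: "d > 0" "\<And>i. i < n \<Longrightarrow> d \<le> e i"
    by (auto simp: d_def e)
  show thesis
  proof (rule that[OF d(1)])
    fix x assume x: "x \<in> topspace (Euclidean_space n)" "\<And>i. i < n \<Longrightarrow> \<bar>x i - c i\<bar> \<le> d"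
    have "x i \<in> B i" for i
    proof (cases "i < n")
      case True
      then show ?thesis using x(2) d(2) e(2) by (meson order_trans)
    next
      case False
      then have "x i = c i" using x(1) c T(2) by (auto simp: topspace_Euclidean_space)
      then show ?thesis using B(3) by auto
    qed
    then show "x \<in> S" using B(4) x(1) T(2) by (auto simp: topspace_Euclidean_space)
  qed
qed

lemma compactin_Euclidean_space_cube:
  "compactin (Euclidean_space n) {x \<in> topspace (Euclidean_space n). \<forall>i<n. \<bar>x i - c i\<bar> \<le> e}"
proof -
  have "compactin (powertop_real UNIV) (Pi\<^sub>E UNIV (\<lambda>i. if i < n then {c i - e..c i + e} else {0}))"
    by (auto simp: compactin_PiE)
  moreover have "Pi\<^sub>E UNIV (\<lambda>i. if i < n then {c i - e..c i + e} else {0}) =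
      {x \<in> topspace (Euclidean_space n). \<forall>i<n. \<bar>x i - c i\<bar> \<le> e}"
    by (auto simp: topspace_Euclidean_space PiE_iff abs_diff_le_iff split: if_splits)
  ultimately show ?thesis
    by (auto simp: Euclidean_space_def compactin_subtopology topspace_Euclidean_space)
qed

text \<open>In a chart, \<open>flat 1 (e\<^sup>2 - \<bar>\<phi> - c\<bar>\<^sup>2)\<close> is supported in a compact cube; as the manifold is
  Hausdorff, the cube is closed in it, so that the extension by zero is smooth.\<close>

lemma smooth_bump_function:
  assumes X: "smooth_manifold X" and W: "openin (mtop X) W" and x0: "x0 \<in> W"
  obtains f :: "'x \<Rightarrow> real" and K where
    "smooth_fun X (pts X) (\<lambda>x. of_real (f x))" "\<And>x. f x \<ge> 0" "f x0 > 0"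
    "closedin (mtop X) K" "K \<subseteq> W" "\<And>x. x \<notin> K \<Longrightarrow> f x = 0"
proof -
  define n where "n = mdim X"
  have "x0 \<in> pts X" using W x0 openin_subset by blast
  then obtain U \<phi> where U: "(U, \<phi>) \<in> matlas X" "x0 \<in> U"
    using X unfolding smooth_manifold_def by blast
  have oU: "openin (mtop X) U" "openin (Euclidean_space n) (\<phi> ` U)"
    and hom: "homeomorphic_map (subtopology (mtop X) U) (subtopology (Euclidean_space n) (\<phi> ` U)) \<phi>"
    using X U by (auto simp: smooth_manifold_def is_chart_def n_def)
  have sub: "\<phi> x \<in> topspace (Euclidean_space n)" if "x \<in> U" for x
    using oU(2) that openin_subset by blast
  define c where "c = \<phi> x0"
  have "openin (Euclidean_space n) (\<phi> ` (U \<inter> W))" "c \<in> \<phi> ` (U \<inter> W)"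
    using chart_openin_image[OF X U(1) W] U(2) x0 by (auto simp: n_def c_def)
  then obtain e where e: "e > 0"
    "\<And>p. p \<in> topspace (Euclidean_space n) \<Longrightarrow> (\<And>i. i < n \<Longrightarrow> \<bar>p i - c i\<bar> \<le> e) \<Longrightarrow> p \<in> \<phi> ` (U \<inter> W)"
    using openin_Euclidean_space_cube by metis
  define Q where "Q = {p \<in> topspace (Euclidean_space n). \<forall>i<n. \<bar>p i - c i\<bar> \<le> e}"
  have QU: "Q \<subseteq> \<phi> ` (U \<inter> W)" using e(2) by (auto simp: Q_def)
  define K where "K = {x \<in> U. \<phi> x \<in> Q}"
  have KW: "K \<subseteq> U \<inter> W"
    using QU chart_inj_on[OF X U(1)] by (fastforce simp: K_def inj_on_def)
  have "\<phi> ` K = Q" using QU by (auto simp: K_def)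
  moreover have "compactin (subtopology (Euclidean_space n) (\<phi> ` U)) Q"
    using compactin_Euclidean_space_cube[of n c e] QU by (auto simp: compactin_subtopology Q_def)
  ultimately have "compactin (subtopology (mtop X) U) K"
    using homeomorphic_map_compactness[OF hom, of K] KW oU(1) openin_subset[OF oU(1)] by auto
  then have "closedin (mtop X) K"
    using X by (auto simp: compactin_subtopology smooth_manifold_def intro: compactin_imp_closedin)
  define q where "q x = e\<^sup>2 - (\<Sum>i<n. (\<phi> x i - c i)\<^sup>2)" for x
  define f where "f x = (if x \<in> U then flat 1 (q x) else 0)" for x
  have zero: "f x = 0" if "x \<notin> K" for x
  proof (rule ccontr)
    assume "f x \<noteq> 0"
    then have x: "x \<in> U" "(\<Sum>i<n. (\<phi> x i - c i)\<^sup>2) < e\<^sup>2"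
      by (auto simp: f_def flat_def q_def split: if_splits)
    have "\<bar>\<phi> x i - c i\<bar> \<le> e" if "i < n" for i
    proof -
      have "(\<phi> x i - c i)\<^sup>2 \<le> (\<Sum>i<n. (\<phi> x i - c i)\<^sup>2)"
        by (rule member_le_sum) (use that in auto)
      with x(2) have "\<bar>\<phi> x i - c i\<bar>\<^sup>2 \<le> e\<^sup>2" by simp
      then show ?thesis using e(1) power2_le_imp_le less_imp_le by metis
    qed
    with x(1) sub that show False by (auto simp: K_def Q_def)
  qed
  have "smooth_fun X U (\<lambda>x. of_real (q x))"
  proof -
    have "smooth_fun X U (\<lambda>x. of_real (e\<^sup>2) + (-1) * (\<Sum>i<n. (of_real (\<phi> x i) + - of_real (c i)) * (of_real (\<phi> x i) + - of_real (c i))))"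
      using smooth_fun_chart_coordinate[OF X U(1)] oU(1) unfolding n_def
      by (intro smooth_fun_add smooth_fun_mult smooth_fun_sum smooth_fun_const) auto
    then show ?thesis
      by (rule smooth_fun_cong[OF X]) (simp add: q_def power2_eq_square)
  qed
  then have "smooth_fun X U (\<lambda>x. of_real (flat 1 (q x)))"
    by (rule smooth_fun_flat)
  then have "smooth_fun X (pts X \<inter> U) (\<lambda>x. of_real (flat 1 (q x)))"
    using openin_subset[OF oU(1)] by (simp add: inf.absorb2)
  then have "smooth_fun X (pts X \<inter> U) (\<lambda>x. of_real (f x))"
    by (rule smooth_fun_cong[OF X]) (auto simp: f_def)
  then have "smooth_fun X (pts X) (\<lambda>x. of_real (f x))"
    by (rule smooth_fun_extend_zero[OF X _ openin_topspace \<open>closedin (mtop X) K\<close>])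
      (use KW zero in auto)
  moreover have "f x0 > 0"
    using U(2) e(1) by (simp add: f_def flat_1_pos_iff q_def c_def)
  moreover have "f x \<ge> 0" for x
    by (simp add: f_def flat_1_nonneg)
  ultimately show thesis
    using that \<open>closedin (mtop X) K\<close> KW zero by blast
qed

lemma smooth_fun_continuous_map:
  assumes X: "smooth_manifold X" and f: "smooth_fun X W f"
  shows "continuous_map (subtopology (mtop X) W) euclidean f"
proof (rule pasting_lemma[where I = "matlas X" and T = "\<lambda>(U, \<phi>). W \<inter> U" and f = "\<lambda>_. f"])
  have W: "openin (mtop X) W" using f by (rule smooth_fun_openin)
  fix c assume c: "c \<in> matlas X"
  obtain U \<phi> where U: "c = (U, \<phi>)" by fastforce
  have oU: "openin (mtop X) U" "openin (Euclidean_space (mdim X)) (\<phi> ` U)"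
    and hom: "homeomorphic_map (subtopology (mtop X) U) (subtopology (Euclidean_space (mdim X)) (\<phi> ` U)) \<phi>"
    using X c by (auto simp: smooth_manifold_def is_chart_def U)
  show "openin (subtopology (mtop X) W) (case c of (U, \<phi>) \<Rightarrow> W \<inter> U)"
    using W oU(1) by (simp add: U openin_open_subtopology openin_Int)
  have "continuous_map (subtopology (mtop X) U) (Euclidean_space (mdim X)) \<phi>"
    using homeomorphic_imp_continuous_map[OF hom] by (simp add: continuous_map_in_subtopology)
  then have "continuous_map (subtopology (mtop X) (U \<inter> W))
      (subtopology (Euclidean_space (mdim X)) (\<phi> ` (U \<inter> W))) \<phi>"
    using continuous_map_from_subtopology_mono[of "mtop X" U _ \<phi> "U \<inter> W"]
    by (auto simp: continuous_map_in_subtopology)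
  from continuous_map_compose[OF this Ck_on_continuous[OF smooth_funD[OF f c[unfolded U], of 0]]]
  have "continuous_map (subtopology (mtop X) (U \<inter> W)) euclidean ((\<lambda>p. f (inv_into U \<phi> p)) \<circ> \<phi>)" .
  then have "continuous_map (subtopology (mtop X) (U \<inter> W)) euclidean f"
    by (rule continuous_map_eq) (use chart_inj_on[OF X c[unfolded U]] in auto)
  then show "continuous_map (subtopology (subtopology (mtop X) W) (case c of (U, \<phi>) \<Rightarrow> W \<inter> U)) euclidean f"
    by (simp add: U subtopology_subtopology Int_commute[of U W] Int_left_absorb)
next
  fix x assume x: "x \<in> topspace (subtopology (mtop X) W)"
  then have "x \<in> pts X" by simp
  then obtain U \<phi> where "(U, \<phi>) \<in> matlas X" "x \<in> U"
    using X unfolding smooth_manifold_def by blast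
  then show "\<exists>c. c \<in> matlas X \<and> x \<in> (case c of (U, \<phi>) \<Rightarrow> W \<inter> U) \<and> f x = f x"
    using x by (intro exI[of _ "(U, \<phi>)"]) auto
qed auto

lemma smooth_fun_openin_superlevel:
  assumes "smooth_manifold X" "smooth_fun X (pts X) (\<lambda>x. of_real (f x))"
  shows "openin (mtop X) {x \<in> pts X. f x > a}"
proof -
  have "continuous_map (mtop X) euclidean (\<lambda>x. complex_of_real (f x))"
    using smooth_fun_continuous_map[OF assms] by simp
  from openin_continuous_map_preimage[OF this, of "{z. Re z > a}"]
  show ?thesis by (simp add: open_Collect_less continuous_on_Re)
qed

text \<open>
  Countably many bump functions \<open>f n\<close> suffice to cover the manifold. They are cut down to a locally
  finite family by the classical device of replacing \<open>{f n > 0}\<close> by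
  \<open>{f n > 0, f i < 1 / (n+1) for all i < n}\<close>: near a point where \<open>f m > 0\<close>, these sets are empty
  for large \<open>n\<close>, and the first \<open>n\<close> with \<open>f n x > 0\<close> is not affected at \<open>x\<close>.
\<close>

lemma locally_finite_bump_family:
  fixes X :: "'x manifold"
  assumes X: "smooth_manifold X" and op: "\<And>U. U \<in> \<U> \<Longrightarrow> openin (mtop X) U"
    and cover: "\<Union>\<U> = pts X" and ne: "\<U> \<noteq> {}"
  obtains \<rho> :: "nat \<Rightarrow> 'x \<Rightarrow> real" and C K :: "nat \<Rightarrow> 'x set" where
    "\<And>n. smooth_fun X (pts X) (\<lambda>x. of_real (\<rho> n x))" "\<And>n x. \<rho> n x \<ge> 0"
    "\<And>n. C n \<in> \<U>" "\<And>n. closedin (mtop X) (K n)" "\<And>n. K n \<subseteq> C n" "\<And>n x. x \<notin> K n \<Longrightarrow> \<rho> n x = 0"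
    "\<And>x. x \<in> pts X \<Longrightarrow> \<exists>n. \<rho> n x > 0"
    "\<And>x. x \<in> pts X \<Longrightarrow> \<exists>V N. openin (mtop X) V \<and> x \<in> V \<and> (\<forall>n\<ge>N. \<forall>y\<in>V. \<rho> n y = 0)"
proof (cases "pts X = {}")
  case True
  obtain U where "U \<in> \<U>" using ne by blast
  show thesis
    by (rule that[of "\<lambda>_ _. 0" "\<lambda>_. U" "\<lambda>_. {}"])
      (use True \<open>U \<in> \<U>\<close> in \<open>auto intro!: smooth_fun_const[of X "{}"]\<close>)
next
  case False
  define good where "good x f K U \<longleftrightarrow> smooth_fun X (pts X) (\<lambda>x. of_real (f x)) \<and> (\<forall>y. f y \<ge> (0::real)) \<and>
      f x > 0 \<and> closedin (mtop X) K \<and> K \<subseteq> U \<and> U \<in> \<U> \<and> (\<forall>y. y \<notin> K \<longrightarrow> f y = 0)" for x f K U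
  have "\<exists>f K U. good x f K U" if "x \<in> pts X" for x
  proof -
    from that cover obtain U where U: "U \<in> \<U>" "x \<in> U" by blast
    show ?thesis
    proof (rule smooth_bump_function[OF X op[OF U(1)] U(2)])
      fix f :: "'x \<Rightarrow> real" and K
      assume "smooth_fun X (pts X) (\<lambda>x. of_real (f x))" "\<And>x. f x \<ge> 0" "f x > 0"
        "closedin (mtop X) K" "K \<subseteq> U" "\<And>x. x \<notin> K \<Longrightarrow> f x = 0"
      with U(1) have "good x f K U" unfolding good_def by simp
      then show ?thesis by blast
    qed
  qed
  then obtain g L D where "\<And>x. x \<in> pts X \<Longrightarrow> good x (g x) (L x) (D x)"
    by metis
  then have g: "\<And>x. x \<in> pts X \<Longrightarrow> smooth_fun X (pts X) (\<lambda>y. of_real (g x y))"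
    "\<And>x y. x \<in> pts X \<Longrightarrow> g x y \<ge> (0::real)" "\<And>x. x \<in> pts X \<Longrightarrow> g x x > 0"
    "\<And>x. x \<in> pts X \<Longrightarrow> closedin (mtop X) (L x)" "\<And>x. x \<in> pts X \<Longrightarrow> L x \<subseteq> D x"
    "\<And>x. x \<in> pts X \<Longrightarrow> D x \<in> \<U>" "\<And>x y. x \<in> pts X \<Longrightarrow> y \<notin> L x \<Longrightarrow> g x y = 0"
    unfolding good_def by simp_all
  define P where "P x = {y \<in> pts X. g x y > 0}" for x
  have "Lindelof_space (mtop X)"
    using X second_countable_imp_Lindelof_space by (auto simp: smooth_manifold_def)
  then have Lind: "\<exists>\<V>. countable \<V> \<and> \<V> \<subseteq> \<U> \<and> \<Union>\<V> = pts X"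
    if "\<And>U. U \<in> \<U> \<Longrightarrow> openin (mtop X) U" "\<Union>\<U> = pts X" for \<U>
    using that by (simp add: Lindelof_space_def)
  have "openin (mtop X) (P x)" if "x \<in> pts X" for x
    unfolding P_def by (rule smooth_fun_openin_superlevel[OF X g(1)[OF that]])
  moreover have "\<Union>(P ` pts X) = pts X"
    using g(3) by (auto simp: P_def)
  ultimately have "\<exists>\<V>. countable \<V> \<and> \<V> \<subseteq> P ` pts X \<and> \<Union>\<V> = pts X"
    by (intro Lind) auto
  then obtain \<V> where \<V>: "countable \<V>" "\<V> \<subseteq> P ` pts X" "\<Union>\<V> = pts X"
    by (elim exE conjE)
  then have "\<exists>J. countable J \<and> J \<subseteq> pts X \<and> \<V> = P ` J"
    by (intro iffD1[OF countable_subset_image] conjI)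
  then obtain J where J: "countable J" "J \<subseteq> pts X" "\<V> = P ` J"
    by (elim exE conjE)
  have "J \<noteq> {}" using \<V>(3) J(3) False by blast
  define e where "e = from_nat_into J"
  have e: "e n \<in> pts X" for n
    using from_nat_into[OF \<open>J \<noteq> {}\<close>, of n] J(2) by (auto simp: e_def)
  define f where "f n = g (e n)" for n
  have f_cover: "\<exists>n. f n x > 0" if "x \<in> pts X" for x
  proof -
    from that \<V>(3) J(3) obtain j where "j \<in> J" "g j x > 0" by (auto simp: P_def)
    moreover obtain n where "e n = j"
      using from_nat_into_surj[OF J(1) \<open>j \<in> J\<close>] by (auto simp: e_def)
    ultimately show ?thesis by (auto simp: f_def)
  qed
  have f: "smooth_fun X (pts X) (\<lambda>x. of_real (f n x))" "f n x \<ge> 0" for n x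
    using g(1,2)[OF e] by (auto simp: f_def)
  define \<rho> where "\<rho> n x = f n x * (\<Prod>i<n. flat 1 (1 / real (Suc n) - f i x))" for n x
  show thesis
  proof (rule that[of \<rho> "\<lambda>n. D (e n)" "\<lambda>n. L (e n)"])
    fix n
    have "smooth_fun X (pts X) (\<lambda>x. of_real (f n x) *
        (\<Prod>i<n. of_real (flat 1 (1 / real (Suc n) - f i x))))"
    proof (intro smooth_fun_mult smooth_fun_prod f smooth_fun_flat)
      fix i
      have "smooth_fun X (pts X) (\<lambda>x. of_real (1 / real (Suc n)) + (-1) * of_real (f i x))"
        by (intro smooth_fun_add smooth_fun_mult smooth_fun_const f) auto
      then show "smooth_fun X (pts X) (\<lambda>x. of_real (1 / real (Suc n) - f i x))"
        by (rule smooth_fun_cong[OF X]) simp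
    qed auto
    then show "smooth_fun X (pts X) (\<lambda>x. of_real (\<rho> n x))"
      by (simp add: \<rho>_def)
    show "\<rho> n x \<ge> 0" for x
      by (auto simp: \<rho>_def intro!: mult_nonneg_nonneg prod_nonneg f flat_1_nonneg)
    show "D (e n) \<in> \<U>" "closedin (mtop X) (L (e n))" "L (e n) \<subseteq> D (e n)"
      using g e by auto
    show "\<rho> n x = 0" if "x \<notin> L (e n)" for x
      using g(7)[OF e that] by (simp add: \<rho>_def f_def)
  next
    fix x assume x: "x \<in> pts X"
    define n where "n = (LEAST n. f n x > 0)"
    have "f n x > 0" unfolding n_def using f_cover[OF x] by (rule LeastI_ex)
    moreover have "f i x = 0" if "i < n" for i
      using not_less_Least[of i "\<lambda>n. f n x > 0"] that f(2)[of i x] by (auto simp: n_def)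
    ultimately have "\<rho> n x > 0"
      by (auto simp: \<rho>_def flat_1_pos_iff intro!: mult_pos_pos prod_pos)
    then show "\<exists>n. \<rho> n x > 0" ..
  next
    fix x assume x: "x \<in> pts X"
    then obtain m where m: "f m x > 0" using f_cover by blast
    obtain N where N: "1 / real (Suc N) < f m x / 2"
      using m by (metis nat_approx_posE half_gt_zero)
    have "\<rho> n y = 0" if "n \<ge> max N (Suc m)" "f m y > f m x / 2" for n y
    proof -
      have "1 / real (Suc n) \<le> 1 / real (Suc N)"
        using that(1) by (auto simp: divide_simps)
      with N that(2) have "1 / real (Suc n) - f m y \<le> 0" by linarith
      then have "flat 1 (1 / real (Suc n) - f m y) = 0" by (simp add: flat_def)
      then have "(\<Prod>i<n. flat 1 (1 / real (Suc n) - f i y)) = 0"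
        using that(1) by (intro prod_zero) (auto intro: bexI[of _ m])
      then show ?thesis by (simp add: \<rho>_def)
    qed
    then show "\<exists>V N. openin (mtop X) V \<and> x \<in> V \<and> (\<forall>n\<ge>N. \<forall>y\<in>V. \<rho> n y = 0)"
      using smooth_fun_openin_superlevel[OF X f(1)[of m], of "f m x / 2"] x m
      by (intro exI[of _ "{y \<in> pts X. f m y > f m x / 2}"] exI[of _ "max N (Suc m)"]) auto
  qed
qed


section \<open>Smooth families of matrices\<close>

lemma minv_inverse:
  assumes "A \<in> carrier_mat n n" "invertible_mat A"
  shows "minv A \<in> carrier_mat n n" "A * minv A = 1\<^sub>m n" "minv A * A = 1\<^sub>m n"
proof -
  from assms obtain B where "A * B = 1\<^sub>m n" "B * A = 1\<^sub>m (dim_row B)"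
    by (auto simp: invertible_mat_def inverts_mat_def)
  moreover from this have "B \<in> carrier_mat n n"
    using assms(1) by (metis carrier_matD(2) carrier_matI index_mult_mat(3) index_one_mat(3))
  ultimately have "A \<in> Units (ring_mat TYPE(complex) n ())"
    using assms(1) by (auto simp: Units_def ring_mat_def)
  then obtain C where "mat_inverse A = Some C"
    using mat_inverse(1)[OF assms(1), of "()"] by fastforce
  then show "minv A \<in> carrier_mat n n" "A * minv A = 1\<^sub>m n" "minv A * A = 1\<^sub>m n"
    using mat_inverse(2)[OF assms(1)] by auto
qed

lemma Ck_on_empty: "Ck_on n k {} f"
  by (induction k arbitrary: f) auto

text \<open>On a set where the dimensions of \<open>T\<close> are constant, the domains in \<open>smooth_mat\<close> are all of \<open>W\<close> or
  empty.\<close>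

lemma smooth_mat_iff_entries:
  assumes W: "openin (mtop X) W" and T: "\<And>x. x \<in> W \<Longrightarrow> T x \<in> carrier_mat a b"
  shows "smooth_mat X W T \<longleftrightarrow> (\<forall>i<a. \<forall>j<b. smooth_fun X W (\<lambda>x. T x $$ (i, j)))"
proof -
  have "{x \<in> W. i < dim_row (T x) \<and> j < dim_col (T x)} = (if i < a \<and> j < b then W else {})" for i j
    using carrier_matD[OF T] by auto
  moreover have "smooth_fun X {} g" for g
    by (rule smooth_funI) (auto intro: Ck_on_empty)
  ultimately show ?thesis
    unfolding smooth_mat_def by auto
qed

lemma smooth_mat_entry:
  assumes "smooth_mat X W T" "openin (mtop X) W" "\<And>x. x \<in> W \<Longrightarrow> T x \<in> carrier_mat a b" "i < a" "j < b"
  shows "smooth_fun X W (\<lambda>x. T x $$ (i, j))"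
  using smooth_mat_iff_entries[of X W T a b] assms by blast

lemma smooth_matI:
  assumes "openin (mtop X) W" "\<And>x. x \<in> W \<Longrightarrow> T x \<in> carrier_mat a b"
    and "\<And>i j. i < a \<Longrightarrow> j < b \<Longrightarrow> smooth_fun X W (\<lambda>x. T x $$ (i, j))"
  shows "smooth_mat X W T"
  using smooth_mat_iff_entries[of X W T a b] assms by blast

lemma smooth_mat_mult:
  assumes X: "smooth_manifold X" and W: "openin (mtop X) W"
    and S: "smooth_mat X W S" "\<And>x. x \<in> W \<Longrightarrow> S x \<in> carrier_mat a b"
    and T: "smooth_mat X W T" "\<And>x. x \<in> W \<Longrightarrow> T x \<in> carrier_mat b c"
  shows "smooth_mat X W (\<lambda>x. S x * T x)"
proof -
  have ST: "S x * T x \<in> carrier_mat a c" if "x \<in> W" for x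
    using mult_carrier_mat[OF S(2)[OF that] T(2)[OF that]] .
  show ?thesis
  proof (rule smooth_matI[OF W ST])
    fix i j assume ij: "i < a" "j < c"
    have "smooth_fun X W (\<lambda>x. \<Sum>k<b. S x $$ (i, k) * T x $$ (k, j))"
      using smooth_mat_entry[OF S(1) W S(2) ij(1)] smooth_mat_entry[OF T(1) W T(2) _ ij(2)]
      by (intro smooth_fun_sum smooth_fun_mult W) auto
    then show "smooth_fun X W (\<lambda>x. (S x * T x) $$ (i, j))"
    proof (rule smooth_fun_cong[OF X])
      fix x assume "x \<in> W"
      then show "(\<Sum>k<b. S x $$ (i, k) * T x $$ (k, j)) = (S x * T x) $$ (i, j)"
        using S(2)[of x] T(2)[of x] ij by (auto simp: scalar_prod_def lessThan_atLeast0)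
    qed
  qed
qed

section \<open>Hermitian metrics\<close>

lemma vector_bundleD:
  assumes "vector_bundle X E" "(U, A) \<in> vb_triv E"
  shows "openin (mtop X) U"
    and "\<And>x y. x \<in> U \<Longrightarrow> y \<in> U \<Longrightarrow> vb_rank E x = vb_rank E y"
    and "\<And>x. x \<in> U \<Longrightarrow> A x \<in> carrier_mat (vb_rank E x) (vb_rank E x)"
    and "\<And>x. x \<in> U \<Longrightarrow> invertible_mat (A x)"
    and "\<And>V B. (V, B) \<in> vb_triv E \<Longrightarrow> smooth_mat X (U \<inter> V) (\<lambda>x. minv (B x) * A x)"
proof -
  note E = assms(1)[unfolded vector_bundle_def]
  note loc = bspec[OF conjunct1[OF E] assms(2), unfolded prod.case]
  show "openin (mtop X) U" using loc by (rule conjunct1)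
  show "vb_rank E x = vb_rank E y" if "x \<in> U" "y \<in> U" for x y
    using conjunct1[OF conjunct2[OF loc]] that by blast
  show "A x \<in> carrier_mat (vb_rank E x) (vb_rank E x)" "invertible_mat (A x)" if "x \<in> U" for x
    using bspec[OF conjunct2[OF conjunct2[OF loc]] that] by simp_all
  show "smooth_mat X (U \<inter> V) (\<lambda>x. minv (B x) * A x)" if "(V, B) \<in> vb_triv E" for V B
    using bspec[OF bspec[OF conjunct2[OF conjunct2[OF E]] assms(2), unfolded prod.case] that, unfolded prod.case] .
qed

lemma vector_bundle_trivE:
  assumes "vector_bundle X E" "x \<in> pts X"
  obtains U A where "(U, A) \<in> vb_triv E" "x \<in> U"
proof -
  have "x \<in> (\<Union>(U, A)\<in>vb_triv E. U)"
    using assms unfolding vector_bundle_def by simp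
  then show thesis using that by blast
qed

lemma vector_bundle_rank_const:
  assumes "vector_bundle X E" "(U, A) \<in> vb_triv E"
  obtains r where "\<And>x. x \<in> U \<Longrightarrow> vb_rank E x = r"
proof (cases "U = {}")
  case False
  then obtain y where "y \<in> U" by blast
  with that show thesis using vector_bundleD(2)[OF assms] by blast
qed (use that in blast)

lemma vector_bundle_minv:
  assumes "vector_bundle X E" "(U, A) \<in> vb_triv E" "x \<in> U"
  shows "minv (A x) \<in> carrier_mat (vb_rank E x) (vb_rank E x)"
    "A x * minv (A x) = 1\<^sub>m (vb_rank E x)" "minv (A x) * A x = 1\<^sub>m (vb_rank E x)"
  using minv_inverse[OF vector_bundleD(3)[OF assms] vector_bundleD(4)[OF assms]] .

lemma mat_adjoint_dim: "dim_row (mat_adjoint A) = dim_col A" "dim_col (mat_adjoint A) = dim_row A"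
  by (auto simp: mat_adjoint_def)

lemma mat_adjoint_index:
  fixes A :: "complex mat"
  assumes "i < dim_col A" "j < dim_row A"
  shows "mat_adjoint A $$ (i, j) = cnj (A $$ (j, i))"
  using assms by (simp add: mat_adjoint_def mat_of_rows_index)

lemma adjoint_mult_mult_index:
  fixes H P Q :: "complex mat"
  assumes "P \<in> carrier_mat r a" "H \<in> carrier_mat r r" "Q \<in> carrier_mat r b" "i < a" "j < b"
  shows "(mat_adjoint P * H * Q) $$ (i, j) = (\<Sum>k<r. \<Sum>l<r. cnj (P $$ (k, i)) * H $$ (k, l) * Q $$ (l, j))"
proof -
  have "(mat_adjoint P * H * Q) $$ (i, j) = (\<Sum>l<r. (\<Sum>k<r. cnj (P $$ (k, i)) * H $$ (k, l)) * Q $$ (l, j))"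
    using assms by (auto simp: scalar_prod_def mat_adjoint_dim mat_adjoint_index lessThan_atLeast0
        intro!: sum.cong arg_cong2[where f = "(*)"])
  also have "\<dots> = (\<Sum>l<r. \<Sum>k<r. cnj (P $$ (k, i)) * H $$ (k, l) * Q $$ (l, j))"
    by (simp add: sum_distrib_right)
  finally show ?thesis by (subst sum.swap)
qed

text \<open>The sesquilinear form of a weighted sum of Gram matrices \<open>B\<^sup>* B\<close>, at vectors \<open>u\<close> and \<open>w\<close>. With \<open>u = w\<close>
  it gives positivity of the glued metric, with columns of a frame its smoothness.\<close>

lemma weighted_gram_form:
  fixes c :: "'n \<Rightarrow> complex" and B :: "'n \<Rightarrow> nat \<Rightarrow> nat \<Rightarrow> complex"
  shows "(\<Sum>i<r. \<Sum>j<r. cnj (u i) * (\<Sum>n\<in>I. c n * (\<Sum>k<r. cnj (B n k i) * B n k j)) * w j) =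
    (\<Sum>n\<in>I. c n * (\<Sum>k<r. cnj (\<Sum>i<r. B n k i * u i) * (\<Sum>j<r. B n k j * w j)))"
proof -
  let ?t = "\<lambda>i j n k. cnj (u i) * c n * cnj (B n k i) * B n k j * w j"
  have "(\<Sum>i<r. \<Sum>j<r. cnj (u i) * (\<Sum>n\<in>I. c n * (\<Sum>k<r. cnj (B n k i) * B n k j)) * w j) =
      (\<Sum>i<r. \<Sum>j<r. \<Sum>n\<in>I. \<Sum>k<r. ?t i j n k)"
    by (simp add: sum_distrib_left sum_distrib_right mult.assoc)
  also have "\<dots> = (\<Sum>n\<in>I. \<Sum>i<r. \<Sum>j<r. \<Sum>k<r. ?t i j n k)"
    by (subst sum.swap[of _ "{..<r}" I], subst sum.swap[of _ "{..<r}" I]) simp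
  also have "\<dots> = (\<Sum>n\<in>I. \<Sum>k<r. \<Sum>i<r. \<Sum>j<r. ?t i j n k)"
  proof (rule sum.cong[OF refl])
    fix n
    have "(\<Sum>i<r. \<Sum>j<r. \<Sum>k<r. ?t i j n k) = (\<Sum>i<r. \<Sum>k<r. \<Sum>j<r. ?t i j n k)"
      by (rule sum.cong[OF refl], rule sum.swap)
    also have "\<dots> = (\<Sum>k<r. \<Sum>i<r. \<Sum>j<r. ?t i j n k)"
      by (rule sum.swap)
    finally show "(\<Sum>i<r. \<Sum>j<r. \<Sum>k<r. ?t i j n k) = (\<Sum>k<r. \<Sum>i<r. \<Sum>j<r. ?t i j n k)" .
  qed
  also have "\<dots> = (\<Sum>n\<in>I. c n * (\<Sum>k<r. cnj (\<Sum>i<r. B n k i * u i) * (\<Sum>j<r. B n k j * w j)))"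
    by (simp add: sum_distrib_left sum_distrib_right sum_product cnj_sum mult_ac)
  finally show ?thesis .
qed

text \<open>
  Each local trivialization \<open>A\<close> carries the flat metric \<open>(A\<^sup>-\<^sup>1)\<^sup>* A\<^sup>-\<^sup>1\<close>; combining these with the
  weights of a locally finite family gives a global metric, since a sum of positive semidefinite
  forms is positive definite as soon as one of them is.
\<close>

lemma hermitian_metric_exists:
  fixes X :: "'x manifold"
  assumes X: "smooth_manifold X" and E: "vector_bundle X E"
  shows "\<exists>h. hermitian_metric X E h"
proof (cases "vb_triv E = {}")
  case True
  with E have "pts X = {}" by (auto simp: vector_bundle_def)
  with True show ?thesis unfolding hermitian_metric_def by simp
next
  case False
  have cover: "\<Union>(fst ` vb_triv E) = pts X"
    using E unfolding vector_bundle_def by (simp add: case_prod_unfold)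
  have op: "openin (mtop X) U" if "U \<in> fst ` vb_triv E" for U
    using that vector_bundleD(1)[OF E] by auto
  have ne: "fst ` vb_triv E \<noteq> {}" using False by simp
  obtain \<rho> :: "nat \<Rightarrow> 'x \<Rightarrow> real" and C K :: "nat \<Rightarrow> 'x set" where
    smooth: "\<And>n. smooth_fun X (pts X) (\<lambda>x. of_real (\<rho> n x))" and nonneg: "\<And>n x. \<rho> n x \<ge> 0" and
    C: "\<And>n. C n \<in> fst ` vb_triv E" and K: "\<And>n. closedin (mtop X) (K n)" "\<And>n. K n \<subseteq> C n" and
    zero: "\<And>n x. x \<notin> K n \<Longrightarrow> \<rho> n x = 0" and
    pos: "\<And>x. x \<in> pts X \<Longrightarrow> \<exists>n. \<rho> n x > 0" and
    loc: "\<And>x. x \<in> pts X \<Longrightarrow> \<exists>V N. openin (mtop X) V \<and> x \<in> V \<and> (\<forall>n\<ge>N. \<forall>y\<in>V. \<rho> n y = 0)"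
    by (rule locally_finite_bump_family[OF X op cover ne]) blast+
  have "\<exists>A. (C n, A) \<in> vb_triv E" for n using C[of n] by force
  then obtain A where A: "\<And>n. (C n, A n) \<in> vb_triv E" by metis
  define B where "B n x = minv (A n x)" for n x
  define I where "I x = {n. \<rho> n x \<noteq> 0}" for x
  have finI: "finite (I x)" if x: "x \<in> pts X" for x
  proof -
    from loc[OF x] obtain V N where "x \<in> V" "\<forall>n\<ge>N. \<forall>y\<in>V. \<rho> n y = 0" by blast
    then have "I x \<subseteq> {..<N}" by (auto simp: I_def not_less[symmetric])
    then show ?thesis using finite_subset by blast
  qed
  have IC: "x \<in> C n" if "n \<in> I x" for n x
    using that zero[of x n] K(2)[of n] by (auto simp: I_def)
  have B: "B n x \<in> carrier_mat (vb_rank E x) (vb_rank E x)" "A n x * B n x = 1\<^sub>m (vb_rank E x)"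
    "A n x \<in> carrier_mat (vb_rank E x) (vb_rank E x)" if "x \<in> C n" for n x
    using vector_bundle_minv(1,2)[OF E A that] vector_bundleD(3)[OF E A that] by (simp_all add: B_def)
  \<comment> \<open>The entries of the sum over \<open>n\<close> of \<open>\<rho> n\<close> times the flat metric of \<open>A n\<close>; for \<open>n \<in> I x\<close> the point
    \<open>x\<close> lies in \<open>C n\<close>, where \<open>B n\<close> is the inverse frame.\<close>
  define g where "g x i j = (\<Sum>n\<in>I x. of_real (\<rho> n x) * (\<Sum>k<vb_rank E x. cnj (B n x $$ (k, i)) * B n x $$ (k, j)))"
    for x i j
  define h where "h x = Matrix.mat (vb_rank E x) (vb_rank E x) (\<lambda>(i, j). g x i j)" for x
  have h_carrier: "h x \<in> carrier_mat (vb_rank E x) (vb_rank E x)" for x by (simp add: h_def)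
  have "hermitian_metric X E h"
    unfolding hermitian_metric_def
  proof (intro conjI ballI impI)
    fix x assume x: "x \<in> pts X"
    show "h x \<in> carrier_mat (vb_rank E x) (vb_rank E x)" by (rule h_carrier)
    show "mat_adjoint (h x) = h x"
      by (rule eq_matI)
        (auto simp: h_def mat_adjoint_dim mat_adjoint_index g_def cnj_sum intro!: sum.cong)
    fix v :: "complex Matrix.vec" assume v: "v \<in> carrier_vec (vb_rank E x)" "v \<noteq> 0\<^sub>v (vb_rank E x)"
    define z where "z n k = (\<Sum>j<vb_rank E x. B n x $$ (k, j) * vec_index v j)" for n k
    have "(h x *\<^sub>v v) \<bullet>c v = (\<Sum>i<vb_rank E x. \<Sum>j<vb_rank E x. cnj (vec_index v i) * g x i j * vec_index v j)"
      using v(1) by (auto simp: h_def scalar_prod_def lessThan_atLeast0 sum_distrib_left sum_distrib_right mult_ac intro!: sum.cong)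
    also have "\<dots> = (\<Sum>n\<in>I x. of_real (\<rho> n x) * (\<Sum>k<vb_rank E x. cnj (z n k) * z n k))"
      unfolding g_def z_def by (rule weighted_gram_form)
    also have "\<dots> = of_real (\<Sum>n\<in>I x. \<rho> n x * (\<Sum>k<vb_rank E x. (cmod (z n k))\<^sup>2))"
      by (simp add: complex_norm_square mult.commute del: of_real_power)
    finally have eq: "Re ((h x *\<^sub>v v) \<bullet>c v) = (\<Sum>n\<in>I x. \<rho> n x * (\<Sum>k<vb_rank E x. (cmod (z n k))\<^sup>2))"
      by simp
    from pos[OF x] obtain n where n: "\<rho> n x > 0" by blast
    then have nI: "n \<in> I x" by (simp add: I_def)
    \<comment> \<open>\<open>z n\<close> is \<open>B n x v\<close>, and \<open>B n x\<close> is injective.\<close>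
    have "\<exists>k<vb_rank E x. z n k \<noteq> 0"
    proof (rule ccontr)
      assume *: "\<not> ?thesis"
      have "B n x *\<^sub>v v = 0\<^sub>v (vb_rank E x)"
        using * B(1)[OF IC[OF nI]] v(1)
        by (intro eq_vecI) (auto simp: z_def scalar_prod_def lessThan_atLeast0)
      then have "(A n x * B n x) *\<^sub>v v = 0\<^sub>v (vb_rank E x)"
        using B[OF IC[OF nI]] v(1) by (subst assoc_mult_mat_vec) auto
      with B(2)[OF IC[OF nI]] v show False by simp
    qed
    then have "(\<Sum>k<vb_rank E x. (cmod (z n k))\<^sup>2) > 0"
      by (auto intro: sum_pos2)
    then show "Re ((h x *\<^sub>v v) \<bullet>c v) > 0"
      unfolding eq using n nI finI[OF x] nonneg
      by (intro sum_pos2[of "I x" n]) (auto intro!: mult_nonneg_nonneg sum_nonneg)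
  next
    fix c assume c: "c \<in> vb_triv E"
    obtain U A' where U: "c = (U, A')" by fastforce
    note c = c[unfolded U]
    obtain r where r: "\<And>x. x \<in> U \<Longrightarrow> vb_rank E x = r"
      using vector_bundle_rank_const[OF E c] by blast
    have oU: "openin (mtop X) U" using vector_bundleD(1)[OF E c] .
    have A': "A' x \<in> carrier_mat r r" if "x \<in> U" for x
      using vector_bundleD(3)[OF E c that] r[OF that] by simp
    have hr: "h x \<in> carrier_mat r r" if "x \<in> U" for x
      using h_carrier[of x] r[OF that] by simp
    have Br: "B n x \<in> carrier_mat r r" if "x \<in> U \<inter> C n" for n x
      using B(1)[of x n] that r[of x] by auto
    \<comment> \<open>The change of frame from \<open>A'\<close> to \<open>A n\<close>, through which the Gram matrix of \<open>h\<close> becomes smooth,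
      although \<open>h\<close> is not expressed in a smooth frame itself.\<close>
    define s where "s n k i x = (B n x * A' x) $$ (k, i)" for n k i x
    have s_smooth: "smooth_fun X (U \<inter> C n) (s n k i)" if "k < r" "i < r" for n k i
      unfolding s_def
    proof (rule smooth_mat_entry[OF _ _ _ that])
      show "smooth_mat X (U \<inter> C n) (\<lambda>x. B n x * A' x)"
        unfolding B_def by (rule vector_bundleD(5)[OF E c A])
      show "openin (mtop X) (U \<inter> C n)"
        using oU vector_bundleD(1)[OF E A] by (rule openin_Int)
      show "B n x * A' x \<in> carrier_mat r r" if "x \<in> U \<inter> C n" for x
        using mult_carrier_mat[OF Br[OF that] A'] that by blast
    qed
    have entry: "(mat_adjoint (A' x) * h x * A' x) $$ (i, j) =
        (\<Sum>n\<in>I x. of_real (\<rho> n x) * (\<Sum>k<r. cnj (s n k i x) * s n k j x))"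
      if x: "x \<in> U" and ij: "i < r" "j < r" for x i j
    proof -
      have "(mat_adjoint (A' x) * h x * A' x) $$ (i, j) =
          (\<Sum>k<r. \<Sum>l<r. cnj (A' x $$ (k, i)) * g x k l * A' x $$ (l, j))"
        by (subst adjoint_mult_mult_index[OF A'[OF x] hr[OF x] A'[OF x] ij]) (simp add: h_def r[OF x])
      also have "\<dots> = (\<Sum>n\<in>I x. of_real (\<rho> n x) *
          (\<Sum>k<r. cnj (\<Sum>l<r. B n x $$ (k, l) * A' x $$ (l, i)) * (\<Sum>l<r. B n x $$ (k, l) * A' x $$ (l, j))))"
        unfolding g_def r[OF x] by (rule weighted_gram_form)
      also have "\<dots> = (\<Sum>n\<in>I x. of_real (\<rho> n x) * (\<Sum>k<r. cnj (s n k i x) * s n k j x))"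
      proof (rule sum.cong[OF refl])
        fix n assume "n \<in> I x"
        then have "B n x \<in> carrier_mat r r" using Br IC x by blast
        then have "s n k l x = (\<Sum>m<r. B n x $$ (k, m) * A' x $$ (m, l))" if "k < r" "l < r" for k l
          using A'[OF x] that by (auto simp: s_def scalar_prod_def lessThan_atLeast0)
        then show "of_real (\<rho> n x) *
          (\<Sum>k<r. cnj (\<Sum>l<r. B n x $$ (k, l) * A' x $$ (l, i)) * (\<Sum>l<r. B n x $$ (k, l) * A' x $$ (l, j))) =
          of_real (\<rho> n x) * (\<Sum>k<r. cnj (s n k i x) * s n k j x)"
          using ij by simp
      qed
      finally show ?thesis .
    qed
    have term_smooth: "smooth_fun X U (\<lambda>x. of_real (\<rho> n x) * (\<Sum>k<r. cnj (s n k i x) * s n k j x))"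
      if "i < r" "j < r" for n i j
    proof (rule smooth_fun_extend_zero[OF X _ oU K(1)[of n] K(2)])
      have "smooth_fun X (U \<inter> C n) (\<lambda>x. of_real (\<rho> n x))"
        using smooth_fun_subset[OF smooth] smooth_fun_openin[OF s_smooth[OF that]] openin_subset by blast
      then show "smooth_fun X (U \<inter> C n) (\<lambda>x. of_real (\<rho> n x) * (\<Sum>k<r. cnj (s n k i x) * s n k j x))"
        using that
        by (intro smooth_fun_mult smooth_fun_sum smooth_fun_cnj s_smooth) (auto dest: smooth_fun_openin)
    qed (simp add: zero)
    have "smooth_mat X U (\<lambda>x. mat_adjoint (A' x) * h x * A' x)"
    proof (rule smooth_matI[OF oU, where a = r and b = r])
      fix x assume x: "x \<in> U"
      then show "mat_adjoint (A' x) * h x * A' x \<in> carrier_mat r r"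
        using A'[OF x] by (auto simp: mat_adjoint_dim intro!: carrier_matI)
    next
      fix i j assume ij: "i < r" "j < r"
      show "smooth_fun X U (\<lambda>x. (mat_adjoint (A' x) * h x * A' x) $$ (i, j))"
      proof (rule smooth_fun_local[OF X oU])
        fix x assume x: "x \<in> U"
        then have "x \<in> pts X" using oU openin_subset by blast
        from loc[OF this] obtain V N where V: "openin (mtop X) V" "x \<in> V" "\<forall>n\<ge>N. \<forall>y\<in>V. \<rho> n y = 0" by blast
        have "smooth_fun X (U \<inter> V) (\<lambda>x. \<Sum>n<N. of_real (\<rho> n x) * (\<Sum>k<r. cnj (s n k i x) * s n k j x))"
          using oU V(1)
          by (intro smooth_fun_sum openin_Int smooth_fun_subset[OF term_smooth[OF ij]]) auto
        moreover have "(\<Sum>n<N. of_real (\<rho> n y) * (\<Sum>k<r. cnj (s n k i y) * s n k j y)) =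
            (mat_adjoint (A' y) * h y * A' y) $$ (i, j)" if y: "y \<in> U \<inter> V" for y
        proof -
          have "I y \<subseteq> {..<N}" using V(3) y by (auto simp: I_def not_less[symmetric])
          then have "(\<Sum>n\<in>I y. of_real (\<rho> n y) * (\<Sum>k<r. cnj (s n k i y) * s n k j y)) =
              (\<Sum>n<N. of_real (\<rho> n y) * (\<Sum>k<r. cnj (s n k i y) * s n k j y))"
            by (intro sum.mono_neutral_left) (auto simp: I_def)
          with entry[of y i j] ij y show ?thesis by simp
        qed
        ultimately have "smooth_fun X (U \<inter> V) (\<lambda>y. (mat_adjoint (A' y) * h y * A' y) $$ (i, j))"
          by (rule smooth_fun_cong[OF X])
        with x V(2) show "\<exists>V. x \<in> V \<and> smooth_fun X V (\<lambda>x. (mat_adjoint (A' x) * h x * A' x) $$ (i, j))"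
          by blast
      qed
    qed
    then show "case c of (U, A) \<Rightarrow> smooth_mat X U (\<lambda>x. mat_adjoint (A x) * h x * A x)"
      by (simp add: U)
  qed
  then show ?thesis by (rule exI[of _ h])
qed

section \<open>Composition of bundle maps\<close>

lemma smooth_mat_cong:
  assumes X: "smooth_manifold X" and T: "smooth_mat X W T" and eq: "\<And>x. x \<in> W \<Longrightarrow> T x = S x"
  shows "smooth_mat X W S"
  unfolding smooth_mat_def
proof (intro allI)
  fix i j
  have "{x \<in> W. i < dim_row (S x) \<and> j < dim_col (S x)} = {x \<in> W. i < dim_row (T x) \<and> j < dim_col (T x)}"
    using eq by auto
  then show "smooth_fun X {x \<in> W. i < dim_row (S x) \<and> j < dim_col (S x)} (\<lambda>x. S x $$ (i, j))"
    using smooth_fun_cong[OF X T[unfolded smooth_mat_def, rule_format, of i j], of "\<lambda>x. S x $$ (i, j)"] eq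
    by simp
qed

lemma smooth_mat_subset:
  assumes T: "smooth_mat X W T" and V: "openin (mtop X) V" "V \<subseteq> W"
    and car: "\<And>x. x \<in> V \<Longrightarrow> T x \<in> carrier_mat a b"
  shows "smooth_mat X V T"
proof (rule smooth_matI[OF V(1) car])
  fix i j assume ij: "i < a" "j < b"
  have "smooth_fun X {x \<in> W. i < dim_row (T x) \<and> j < dim_col (T x)} (\<lambda>x. T x $$ (i, j))"
    using T unfolding smooth_mat_def by blast
  then show "smooth_fun X V (\<lambda>x. T x $$ (i, j))"
    by (rule smooth_fun_subset[OF _ V(1)]) (use V(2) ij carrier_matD[OF car] in auto)
qed

lemma bundle_mapD:
  assumes "bundle_map X E F T"
  shows "\<And>x. x \<in> pts X \<Longrightarrow> T x \<in> carrier_mat (vb_rank F x) (vb_rank E x)"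
    and "\<And>U A V B. (U, A) \<in> vb_triv E \<Longrightarrow> (V, B) \<in> vb_triv F \<Longrightarrow> smooth_mat X (U \<inter> V) (\<lambda>x. minv (B x) * T x * A x)"
proof -
  note T = assms[unfolded bundle_map_def]
  show "T x \<in> carrier_mat (vb_rank F x) (vb_rank E x)" if "x \<in> pts X" for x
    using bspec[OF conjunct1[OF T] that] .
  show "smooth_mat X (U \<inter> V) (\<lambda>x. minv (B x) * T x * A x)"
    if "(U, A) \<in> vb_triv E" "(V, B) \<in> vb_triv F" for U A V B
    using bspec[OF bspec[OF conjunct2[OF T] that(1), unfolded prod.case] that(2), unfolded prod.case] .
qed

lemma bundle_mapI:
  assumes "\<And>x. x \<in> pts X \<Longrightarrow> T x \<in> carrier_mat (vb_rank F x) (vb_rank E x)"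
    and "\<And>U A V B. (U, A) \<in> vb_triv E \<Longrightarrow> (V, B) \<in> vb_triv F \<Longrightarrow> smooth_mat X (U \<inter> V) (\<lambda>x. minv (B x) * T x * A x)"
  shows "bundle_map X E F T"
  unfolding bundle_map_def using assms by (intro conjI ballI) auto

lemma bundle_map_cong:
  assumes X: "smooth_manifold X" and E: "vector_bundle X E"
    and T: "bundle_map X E F T" and eq: "\<And>x. x \<in> pts X \<Longrightarrow> T x = S x"
  shows "bundle_map X E F S"
proof (rule bundle_mapI)
  show "S x \<in> carrier_mat (vb_rank F x) (vb_rank E x)" if "x \<in> pts X" for x
    using bundle_mapD(1)[OF T that] eq[OF that] by simp
  fix U A V B assume UV: "(U, A) \<in> vb_triv E" "(V, B) \<in> vb_triv F"
  have "x \<in> pts X" if "x \<in> U" for x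
    using vector_bundleD(1)[OF E UV(1)] openin_subset that by blast
  then show "smooth_mat X (U \<inter> V) (\<lambda>x. minv (B x) * S x * A x)"
    by (intro smooth_mat_cong[OF X bundle_mapD(2)[OF T UV]]) (simp add: eq)
qed

lemma bundle_map_id:
  assumes X: "smooth_manifold X" and E: "vector_bundle X E"
  shows "bundle_map X E E (\<lambda>x. 1\<^sub>m (vb_rank E x))"
proof (rule bundle_mapI)
  fix U A V B assume U: "(U, A) \<in> vb_triv E" and V: "(V, B) \<in> vb_triv E"
  show "smooth_mat X (U \<inter> V) (\<lambda>x. minv (B x) * 1\<^sub>m (vb_rank E x) * A x)"
  proof (rule smooth_mat_cong[OF X vector_bundleD(5)[OF E U V]])
    fix x assume "x \<in> U \<inter> V"
    then show "minv (B x) * A x = minv (B x) * 1\<^sub>m (vb_rank E x) * A x"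
      using right_mult_one_mat[OF vector_bundle_minv(1)[OF E V, of x]] by simp
  qed
qed simp

text \<open>Locally, \<open>C\<^sup>-\<^sup>1 S T A = (C\<^sup>-\<^sup>1 S B) (B\<^sup>-\<^sup>1 T A)\<close> for any trivialization \<open>B\<close> of the bundle in the
  middle.\<close>

lemma bundle_map_compose:
  assumes X: "smooth_manifold X"
    and E: "vector_bundle X E" and F: "vector_bundle X F" and G: "vector_bundle X G"
    and T: "bundle_map X E F T" and S: "bundle_map X F G S"
  shows "bundle_map X E G (\<lambda>x. S x * T x)"
proof (rule bundle_mapI)
  show "S x * T x \<in> carrier_mat (vb_rank G x) (vb_rank E x)" if "x \<in> pts X" for x
    using mult_carrier_mat[OF bundle_mapD(1)[OF S that] bundle_mapD(1)[OF T that]] .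
  fix U A W C assume U: "(U, A) \<in> vb_triv E" and W: "(W, C) \<in> vb_triv G"
  let ?M = "\<lambda>x. minv (C x) * (S x * T x) * A x"
  obtain a where a: "\<And>x. x \<in> U \<Longrightarrow> vb_rank E x = a" using vector_bundle_rank_const[OF E U] by blast
  obtain c where c: "\<And>x. x \<in> W \<Longrightarrow> vb_rank G x = c" using vector_bundle_rank_const[OF G W] by blast
  have oUW: "openin (mtop X) (U \<inter> W)"
    using vector_bundleD(1)[OF E U] vector_bundleD(1)[OF G W] by (rule openin_Int)
  have pts: "x \<in> pts X" if "x \<in> U \<inter> W" for x
    using oUW openin_subset that by blast
  note carr = vector_bundleD(3)[OF E U] vector_bundle_minv(1)[OF G W] bundle_mapD(1)[OF S] bundle_mapD(1)[OF T]
  have M: "?M x \<in> carrier_mat c a" if "x \<in> U \<inter> W" for x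
    using carr(1)[of x] carr(2)[of x] carr(3,4)[OF pts[OF that]] that a c
    by (intro mult_carrier_mat[of _ _ "vb_rank E x"] mult_carrier_mat[of _ _ "vb_rank G x"]
        mult_carrier_mat[of _ _ "vb_rank F x"]) auto
  show "smooth_mat X (U \<inter> W) ?M"
  proof (rule smooth_matI[OF oUW M])
    fix i j assume ij: "i < c" "j < a"
    show "smooth_fun X (U \<inter> W) (\<lambda>x. ?M x $$ (i, j))"
    proof (rule smooth_fun_local[OF X oUW])
      fix x assume x: "x \<in> U \<inter> W"
      obtain V B where V: "(V, B) \<in> vb_triv F" "x \<in> V"
        using vector_bundle_trivE[OF F pts[OF x]] by blast
      obtain b where b: "\<And>x. x \<in> V \<Longrightarrow> vb_rank F x = b" using vector_bundle_rank_const[OF F V(1)] by blast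
      define Q where "Q = U \<inter> W \<inter> V"
      have oQ: "openin (mtop X) Q"
        using oUW vector_bundleD(1)[OF F V(1)] by (auto simp: Q_def)
      have car: "A y \<in> carrier_mat a a" "minv (C y) \<in> carrier_mat c c" "B y \<in> carrier_mat b b"
        "minv (B y) \<in> carrier_mat b b" "S y \<in> carrier_mat c b" "T y \<in> carrier_mat b a"
        "B y * minv (B y) = 1\<^sub>m b" if "y \<in> Q" for y
        using that carr(1)[of y] carr(2)[of y] carr(3,4)[OF pts, of y] vector_bundleD(3)[OF F V(1), of y]
          vector_bundle_minv(1,2)[OF F V(1), of y] a[of y] b[of y] c[of y] by (auto simp: Q_def)
      have CSB: "minv (C y) * S y * B y \<in> carrier_mat c b" and BTA: "minv (B y) * T y * A y \<in> carrier_mat b a"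
        if "y \<in> Q" for y
        using mult_carrier_mat[OF mult_carrier_mat[OF car(2,5)[OF that]] car(3)[OF that]]
          mult_carrier_mat[OF mult_carrier_mat[OF car(4,6)[OF that]] car(1)[OF that]] .
      have smS: "smooth_mat X Q (\<lambda>x. minv (C x) * S x * B x)" and smT: "smooth_mat X Q (\<lambda>x. minv (B x) * T x * A x)"
        using smooth_mat_subset[OF bundle_mapD(2)[OF S V(1) W] oQ _ CSB] smooth_mat_subset[OF bundle_mapD(2)[OF T U V(1)] oQ _ BTA]
        by (auto simp: Q_def)
      have "smooth_mat X Q (\<lambda>x. (minv (C x) * S x * B x) * (minv (B x) * T x * A x))"
        by (rule smooth_mat_mult[OF X oQ smS CSB smT BTA])
      moreover have "(minv (C y) * S y * B y) * (minv (B y) * T y * A y) = ?M y" if "y \<in> Q" for y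
      proof -
        note car = car[OF that]
        have CS: "minv (C y) * S y \<in> carrier_mat c b" and TA: "T y * A y \<in> carrier_mat b a"
          using mult_carrier_mat[OF car(2,5)] mult_carrier_mat[OF car(6,1)] .
        have "(minv (C y) * S y * B y) * (minv (B y) * T y * A y) =
            (minv (C y) * S y) * (B y * (minv (B y) * (T y * A y)))"
          using assoc_mult_mat[OF car(4,6,1)] assoc_mult_mat[OF CS car(3) mult_carrier_mat[OF car(4) TA]] by simp
        also have "B y * (minv (B y) * (T y * A y)) = T y * A y"
          using assoc_mult_mat[OF car(3,4) TA] car(7) left_mult_one_mat[OF TA] by simp
        also have "(minv (C y) * S y) * (T y * A y) = minv (C y) * (S y * T y) * A y"
          using assoc_mult_mat[OF car(2,5) TA] assoc_mult_mat[OF car(5,6,1)]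
            assoc_mult_mat[OF car(2) mult_carrier_mat[OF car(5,6)] car(1)] by simp
        finally show ?thesis .
      qed
      ultimately have "smooth_mat X Q ?M" by (rule smooth_mat_cong[OF X])
      then have "smooth_fun X Q (\<lambda>x. ?M x $$ (i, j))"
        by (rule smooth_mat_entry[OF _ oQ _ ij]) (use M in \<open>auto simp: Q_def\<close>)
      then show "\<exists>V. x \<in> V \<and> smooth_fun X V (\<lambda>x. ?M x $$ (i, j))"
        using x V(2) by (intro exI[of _ Q]) (auto simp: Q_def)
    qed
  qed
qed

section \<open>The category of twisted vector bundles\<close>

lemma kron_one_1_left: "1\<^sub>m 1 \<otimes>\<^sub>k A = A"
  by (rule eq_matI) (auto simp: kron_def)

lemma kron_one_1_right: "A \<otimes>\<^sub>k 1\<^sub>m 1 = A"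
  by (rule eq_matI) (auto simp: kron_def)

lemma ev_mat_1x1: "D \<in> carrier_mat 1 1 \<Longrightarrow> ev_mat D = D"
  by (rule eq_matI) (auto simp: ev_mat_def)

text \<open>Since \<open>\<complex>\<^sup>1 \<otimes> V\<close> is literally \<open>V\<close>, compatibility with the action reads
  \<open>T (s g) \<cdot> act g = act g \<cdot> T (t g)\<close>, and such squares can be pasted.\<close>

lemma category_twisted_bundles:
  assumes obj: "smooth_manifold (gobj G)"
    and st: "\<And>g. g \<in> pts (garr G) \<Longrightarrow> gsrc G g \<in> pts (gobj G) \<and> gtgt G g \<in> pts (gobj G)"
    and line: "\<And>g. g \<in> pts (garr G) \<Longrightarrow> vb_rank (gg_L \<L>) g = 1"
  shows "category (tvb_category G \<L>)"
proof -
  have act: "tvb_act E g \<in> carrier_mat (vb_rank (tvb_bundle E) (gsrc G g)) (vb_rank (tvb_bundle E) (gtgt G g))"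
    if "is_twisted_bundle G \<L> E" "g \<in> pts (garr G)" for E g
  proof -
    have "bundle_map (garr G) (tensor_bundle (gg_L \<L>) (pullback (garr G) (gtgt G) (tvb_bundle E)))
       (pullback (garr G) (gsrc G) (tvb_bundle E)) (tvb_act E)"
      using that(1) unfolding is_twisted_bundle_def bundle_iso_def by blast
    from bundle_mapD(1)[OF this that(2)] show ?thesis
      by (simp add: pullback_def tensor_bundle_def line[OF that(2)])
  qed
  have vb: "vector_bundle (gobj G) (tvb_bundle E)" if "is_twisted_bundle G \<L> E" for E
    using that unfolding is_twisted_bundle_def by blast
  have hom: "T \<in> tvb_hom G \<L> E F \<longleftrightarrow> T \<in> extensional (pts (gobj G)) \<and>
      bundle_map (gobj G) (tvb_bundle E) (tvb_bundle F) T \<and>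
      (\<forall>g\<in>pts (garr G). T (gsrc G g) * tvb_act E g = tvb_act F g * T (gtgt G g))" for T E F
    unfolding tvb_hom_def using line by (auto simp: kron_one_1_left simp del: One_nat_def)
  have carr: "T u \<in> carrier_mat (vb_rank (tvb_bundle F) u) (vb_rank (tvb_bundle E) u)"
    if "T \<in> tvb_hom G \<L> E F" "u \<in> pts (gobj G)" for T E F u
    by (rule bundle_mapD(1)[OF conjunct1[OF conjunct2[OF iffD1[OF hom that(1)]]] that(2)])
  have id_hom: "(\<lambda>u\<in>pts (gobj G). 1\<^sub>m (vb_rank (tvb_bundle E) u)) \<in> tvb_hom G \<L> E E"
    if E: "is_twisted_bundle G \<L> E" for E
    unfolding hom
  proof (intro conjI ballI)
    show "bundle_map (gobj G) (tvb_bundle E) (tvb_bundle E) (\<lambda>u\<in>pts (gobj G). 1\<^sub>m (vb_rank (tvb_bundle E) u))"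
      by (rule bundle_map_cong[OF obj vb[OF E] bundle_map_id[OF obj vb[OF E]]]) simp
    fix g assume g: "g \<in> pts (garr G)"
    show "(\<lambda>u\<in>pts (gobj G). 1\<^sub>m (vb_rank (tvb_bundle E) u)) (gsrc G g) * tvb_act E g =
        tvb_act E g * (\<lambda>u\<in>pts (gobj G). 1\<^sub>m (vb_rank (tvb_bundle E) u)) (gtgt G g)"
      using st[OF g] left_mult_one_mat[OF act[OF E g]] right_mult_one_mat[OF act[OF E g]] by simp
  qed simp
  have comp_hom: "(\<lambda>u\<in>pts (gobj G). S u * T u) \<in> tvb_hom G \<L> E H"
    if E: "is_twisted_bundle G \<L> E" and F: "is_twisted_bundle G \<L> F" and H: "is_twisted_bundle G \<L> H"
      and T: "T \<in> tvb_hom G \<L> E F" and S: "S \<in> tvb_hom G \<L> F H" for E F H T S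
    unfolding hom
  proof (intro conjI ballI)
    have "bundle_map (gobj G) (tvb_bundle E) (tvb_bundle H) (\<lambda>u. S u * T u)"
      using T S unfolding hom by (intro bundle_map_compose[OF obj vb[OF E] vb[OF F] vb[OF H]]) auto
    then show "bundle_map (gobj G) (tvb_bundle E) (tvb_bundle H) (\<lambda>u\<in>pts (gobj G). S u * T u)"
      by (rule bundle_map_cong[OF obj vb[OF E]]) simp
    fix g assume g: "g \<in> pts (garr G)"
    note s = conjunct1[OF st[OF g]] and t = conjunct2[OF st[OF g]]
    have eqs: "T (gsrc G g) * tvb_act E g = tvb_act F g * T (gtgt G g)"
      "S (gsrc G g) * tvb_act F g = tvb_act H g * S (gtgt G g)"
      using T S g unfolding hom by blast+
    have "S (gsrc G g) * T (gsrc G g) * tvb_act E g = S (gsrc G g) * (tvb_act F g * T (gtgt G g))"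
      using assoc_mult_mat[OF carr[OF S s] carr[OF T s] act[OF E g]] eqs(1) by simp
    also have "\<dots> = tvb_act H g * S (gtgt G g) * T (gtgt G g)"
      using assoc_mult_mat[OF carr[OF S s] act[OF F g] carr[OF T t]] eqs(2) by simp
    also have "\<dots> = tvb_act H g * (S (gtgt G g) * T (gtgt G g))"
      by (rule assoc_mult_mat[OF act[OF H g] carr[OF S t] carr[OF T t]])
    finally show "(\<lambda>u\<in>pts (gobj G). S u * T u) (gsrc G g) * tvb_act E g =
        tvb_act H g * (\<lambda>u\<in>pts (gobj G). S u * T u) (gtgt G g)"
      using s t by simp
  qed simp
  have unit: "(\<lambda>u\<in>pts (gobj G). T u * (\<lambda>u\<in>pts (gobj G). 1\<^sub>m (vb_rank (tvb_bundle E) u)) u) = T"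
    "(\<lambda>u\<in>pts (gobj G). (\<lambda>u\<in>pts (gobj G). 1\<^sub>m (vb_rank (tvb_bundle F) u)) u * T u) = T"
    if T: "T \<in> tvb_hom G \<L> E F" for E F T
  proof -
    have ext: "T \<in> extensional (pts (gobj G))" using T unfolding hom by blast
    show "(\<lambda>u\<in>pts (gobj G). T u * (\<lambda>u\<in>pts (gobj G). 1\<^sub>m (vb_rank (tvb_bundle E) u)) u) = T"
      by (rule extensionalityI[OF restrict_extensional ext]) (simp add: right_mult_one_mat[OF carr[OF T]])
    show "(\<lambda>u\<in>pts (gobj G). (\<lambda>u\<in>pts (gobj G). 1\<^sub>m (vb_rank (tvb_bundle F) u)) u * T u) = T"
      by (rule extensionalityI[OF restrict_extensional ext]) (simp add: left_mult_one_mat[OF carr[OF T]])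
  qed
  have assoc: "(\<lambda>u\<in>pts (gobj G). R u * (\<lambda>u\<in>pts (gobj G). S u * T u) u) =
      (\<lambda>u\<in>pts (gobj G). (\<lambda>u\<in>pts (gobj G). R u * S u) u * T u)"
    if T: "T \<in> tvb_hom G \<L> E F" and S: "S \<in> tvb_hom G \<L> F H" and R: "R \<in> tvb_hom G \<L> H K" for E F H K T S R
    by (rule restrict_ext) (simp add: assoc_mult_mat[OF carr[OF R] carr[OF S] carr[OF T]])
  show ?thesis
    unfolding category_def tvb_category_def precategory.simps
  proof (intro conjI ballI; elim CollectE)
    show "(\<lambda>u\<in>pts (gobj G). 1\<^sub>m (vb_rank (tvb_bundle E) u)) \<in> tvb_hom G \<L> E E"
      if "is_twisted_bundle G \<L> E" for E
      using that by (rule id_hom)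
  next
    fix E F H T S
    assume "is_twisted_bundle G \<L> E" "is_twisted_bundle G \<L> F" "is_twisted_bundle G \<L> H"
      "T \<in> tvb_hom G \<L> E F" "S \<in> tvb_hom G \<L> F H"
    then show "(\<lambda>u\<in>pts (gobj G). S u * T u) \<in> tvb_hom G \<L> E H"
      by (rule comp_hom)
  qed (rule unit assoc, assumption+)+
qed

section \<open>Grothendieck groups of isomorphic structures\<close>

lemma carrier_grothendieck:
  "carrier (grothendieck M) = (\<lambda>p. groth_rel M `` {p}) ` (carrier M \<times> carrier M)"
  by (auto simp: grothendieck_def quotient_def)

text \<open>
  The map \<open>\<psi>\<close> has to be injective on a set \<open>S\<close> that is closed under the products, and not only on the
  carrier: the defining relation compares triple products, and the product of two classes of
  pairs is formed from products of representatives. Neither kind of product is assumed to lie in the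
  carrier.
\<close>

lemma grothendieck_iso:
  fixes M :: "'m monoid" and N :: "'n monoid"
  assumes inj: "inj_on \<psi> S" and sub: "carrier N \<subseteq> S" and surj: "\<psi> ` carrier N = carrier M"
    and mult: "\<And>P Q. P \<in> S \<Longrightarrow> Q \<in> S \<Longrightarrow> P \<otimes>\<^bsub>N\<^esub> Q \<in> S \<and> \<psi> (P \<otimes>\<^bsub>N\<^esub> Q) = \<psi> P \<otimes>\<^bsub>M\<^esub> \<psi> Q"
  shows "grothendieck N \<cong> grothendieck M"
proof -
  let ?C = "carrier N \<times> carrier N" and ?D = "carrier M \<times> carrier M"
  define \<Psi> where "\<Psi> = map_prod \<psi> \<psi>"
  have mem: "\<psi> P \<in> carrier M \<longleftrightarrow> P \<in> carrier N" if "P \<in> S" for P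
    using inj_on_image_mem_iff[OF inj that sub] surj by simp
  have image_C: "\<Psi> ` ?C = ?D"
    unfolding \<Psi>_def by (rule map_prod_surj_on[OF surj surj])
  have inj_C: "inj_on \<Psi> ?C"
    unfolding \<Psi>_def using inj_on_subset[OF inj sub] by (intro map_prod_inj_on)
  have triple: "\<psi> x \<otimes>\<^bsub>M\<^esub> \<psi> y \<otimes>\<^bsub>M\<^esub> \<psi> z = \<psi> (x \<otimes>\<^bsub>N\<^esub> y \<otimes>\<^bsub>N\<^esub> z)" "x \<otimes>\<^bsub>N\<^esub> y \<otimes>\<^bsub>N\<^esub> z \<in> S"
    if "x \<in> S" "y \<in> S" "z \<in> S" for x y z
    using that by (simp_all add: mult)
  have rel: "((\<psi> a, \<psi> b), (\<psi> c, \<psi> d)) \<in> groth_rel M \<longleftrightarrow> ((a, b), (c, d)) \<in> groth_rel N"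
    if "a \<in> S" "b \<in> S" "c \<in> S" "d \<in> S" for a b c d
  proof -
    have "(\<psi> a \<otimes>\<^bsub>M\<^esub> \<psi> d \<otimes>\<^bsub>M\<^esub> \<psi> k = \<psi> c \<otimes>\<^bsub>M\<^esub> \<psi> b \<otimes>\<^bsub>M\<^esub> \<psi> k) \<longleftrightarrow>
        (a \<otimes>\<^bsub>N\<^esub> d \<otimes>\<^bsub>N\<^esub> k = c \<otimes>\<^bsub>N\<^esub> b \<otimes>\<^bsub>N\<^esub> k)" if "k \<in> carrier N" for k
    proof -
      have "k \<in> S" using that sub by blast
      then show ?thesis
        using triple[OF \<open>a \<in> S\<close> \<open>d \<in> S\<close>] triple[OF \<open>c \<in> S\<close> \<open>b \<in> S\<close>]
        by (simp add: inj_on_eq_iff[OF inj])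
    qed
    then have "(\<exists>k\<in>carrier M. \<psi> a \<otimes>\<^bsub>M\<^esub> \<psi> d \<otimes>\<^bsub>M\<^esub> k = \<psi> c \<otimes>\<^bsub>M\<^esub> \<psi> b \<otimes>\<^bsub>M\<^esub> k) \<longleftrightarrow>
        (\<exists>k\<in>carrier N. a \<otimes>\<^bsub>N\<^esub> d \<otimes>\<^bsub>N\<^esub> k = c \<otimes>\<^bsub>N\<^esub> b \<otimes>\<^bsub>N\<^esub> k)"
      unfolding surj[symmetric] by simp
    then show ?thesis
      using that by (simp add: groth_rel_def mem)
  qed
  have rel_sub: "groth_rel N \<subseteq> ?C \<times> ?C" "groth_rel M \<subseteq> ?D \<times> ?D"
    by (auto simp: groth_rel_def)
  have class_eq: "\<Psi> ` (groth_rel N `` {p}) = groth_rel M `` {\<Psi> p}" if p: "p \<in> S \<times> S" for p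
  proof
    obtain a b where ab: "p = (a, b)" "a \<in> S" "b \<in> S" using p by blast
    show "\<Psi> ` (groth_rel N `` {p}) \<subseteq> groth_rel M `` {\<Psi> p}"
    proof (rule image_subsetI)
      fix q assume q: "q \<in> groth_rel N `` {p}"
      obtain c d where cd: "q = (c, d)" by fastforce
      with q rel_sub sub have "c \<in> S" "d \<in> S" by blast+
      with q show "\<Psi> q \<in> groth_rel M `` {\<Psi> p}" by (simp add: ab cd \<Psi>_def rel)
    qed
    show "groth_rel M `` {\<Psi> p} \<subseteq> \<Psi> ` (groth_rel N `` {p})"
    proof
      fix q' assume q': "q' \<in> groth_rel M `` {\<Psi> p}"
      then have "q' \<in> \<Psi> ` ?C" using rel_sub image_C by blast
      then obtain c d where cd: "q' = \<Psi> (c, d)" "c \<in> carrier N" "d \<in> carrier N" by blast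
      then have "c \<in> S" "d \<in> S" using sub by blast+
      with q' have "(c, d) \<in> groth_rel N `` {p}" by (simp add: ab cd \<Psi>_def rel)
      then show "q' \<in> \<Psi> ` (groth_rel N `` {p})" unfolding cd(1) by (rule imageI)
    qed
  qed
  have sub_C: "p \<in> S \<times> S" if "p \<in> ?C" for p using that sub by blast
  have bij: "bij_betw (image \<Psi>) (carrier (grothendieck N)) (carrier (grothendieck M))"
    unfolding bij_betw_def
  proof
    have "carrier (grothendieck N) \<subseteq> Pow ?C"
      using rel_sub(1) by (auto simp: carrier_grothendieck)
    then show "inj_on (image \<Psi>) (carrier (grothendieck N))"
      using inj_on_image_Pow[OF inj_C] inj_on_subset by blast
    show "image \<Psi> ` carrier (grothendieck N) = carrier (grothendieck M)"
      unfolding carrier_grothendieck image_image image_C[symmetric]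
      by (rule image_cong[OF refl class_eq[OF sub_C]])
  qed
  have hom: "\<Psi> ` (P \<otimes>\<^bsub>grothendieck N\<^esub> Q) = \<Psi> ` P \<otimes>\<^bsub>grothendieck M\<^esub> \<Psi> ` Q"
    if PQ: "P \<in> carrier (grothendieck N)" "Q \<in> carrier (grothendieck N)" for P Q
  proof -
    have PQ_sub: "P \<subseteq> S \<times> S" "Q \<subseteq> S \<times> S"
      using PQ rel_sub(1) sub unfolding carrier_grothendieck by blast+
    have step: "\<Psi> ` (groth_rel N `` {(a \<otimes>\<^bsub>N\<^esub> c, b \<otimes>\<^bsub>N\<^esub> d)}) =
        groth_rel M `` {(\<psi> a \<otimes>\<^bsub>M\<^esub> \<psi> c, \<psi> b \<otimes>\<^bsub>M\<^esub> \<psi> d)}"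
      if "(a, b) \<in> P" "(c, d) \<in> Q" for a b c d
    proof -
      have "a \<in> S" "b \<in> S" "c \<in> S" "d \<in> S" using that PQ_sub by blast+
      then show ?thesis using class_eq[of "(a \<otimes>\<^bsub>N\<^esub> c, b \<otimes>\<^bsub>N\<^esub> d)"] mult by (simp add: \<Psi>_def)
    qed
    have "\<Psi> ` (P \<otimes>\<^bsub>grothendieck N\<^esub> Q) =
        (\<Union>p\<in>P. \<Union>q\<in>Q. \<Psi> ` (groth_rel N `` {(fst p \<otimes>\<^bsub>N\<^esub> fst q, snd p \<otimes>\<^bsub>N\<^esub> snd q)}))"
      by (simp add: grothendieck_def case_prod_unfold image_UN)
    also have "\<dots> = (\<Union>p\<in>P. \<Union>q\<in>Q. groth_rel M `` {(\<psi> (fst p) \<otimes>\<^bsub>M\<^esub> \<psi> (fst q), \<psi> (snd p) \<otimes>\<^bsub>M\<^esub> \<psi> (snd q))})"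
      by (intro SUP_cong refl step) simp_all
    also have "\<dots> = \<Psi> ` P \<otimes>\<^bsub>grothendieck M\<^esub> \<Psi> ` Q"
      by (simp add: grothendieck_def case_prod_unfold \<Psi>_def)
    finally show ?thesis .
  qed
  have "image \<Psi> \<in> iso (grothendieck N) (grothendieck M)"
    unfolding iso_def hom_def using bij hom by (auto simp: bij_betw_def)
  then show ?thesis by (auto simp: is_iso_def)
qed


section \<open>Forgetting structure on the objects of a category\<close>

text \<open>
  The situation in which \<open>F\<close> forgets a structure that can be chosen on every object and that is not
  seen by morphisms. The equations for \<open>Hom\<close> and \<open>Idn\<close> are required for all \<open>a\<close> and \<open>b\<close>, including
  those outside \<open>Ob C\<close>, because a sum of objects is compared with its image before it is known to be an object.
\<close>

locale forgetful =
  fixes C :: "('o, 'a) precategory" and D :: "('p, 'a) precategory" and F :: "'o \<Rightarrow> 'p"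
  assumes Ob: "F ` Ob C = Ob D"
    and Hom: "\<And>a b. Hom C a b = Hom D (F a) (F b)"
    and Idn: "\<And>a. Idn C a = Idn D (F a)"
    and Cmp: "Cmp C = Cmp D"
begin

lemma Ob_F: "a \<in> Ob C \<Longrightarrow> F a \<in> Ob D"
  using Ob by blast

lemma iso_in_F: "iso_in C a b = iso_in D (F a) (F b)"
  by (simp add: iso_in_def Hom Idn Cmp)

lemma category_C: "category D \<Longrightarrow> category C"
  unfolding category_def Hom Idn Cmp using Ob_F by blast

lemma equivalent:
  assumes D: "category D"
  shows "equivalent_categories C D"
proof -
  define R where "R = inv_into (Ob C) F"
  have R: "R p \<in> Ob C" "F (R p) = p" if "p \<in> Ob D" for p
    using that Ob by (auto simp: R_def inv_into_into f_inv_into_f)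
  have idn: "Idn D p \<in> Hom D p p" if "p \<in> Ob D" for p
    using D that unfolding category_def by blast
  have unit: "Cmp D f (Idn D p) = f" "Cmp D (Idn D q) f = f"
    if "p \<in> Ob D" "q \<in> Ob D" "f \<in> Hom D p q" for p q f
    using D that unfolding category_def by blast+
  have idn_iso: "Idn D p \<in> iso_in D p p" if "p \<in> Ob D" for p
    using unit[OF that that idn[OF that]] idn[OF that] unfolding iso_in_def by blast
  have unit_commute: "Cmp D (Idn D q) f = Cmp D f (Idn D p)"
    if "p \<in> Ob D" "q \<in> Ob D" "f \<in> Hom D p q" for p q f
    using unit[OF that] by simp
  have "is_functor C D F (\<lambda>a b f. f)"
    unfolding is_functor_def using Ob_F by (simp add: Hom Idn Cmp)
  moreover have "is_functor D C R (\<lambda>p q f. f)"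
    unfolding is_functor_def using R by (simp add: Hom Idn Cmp)
  moreover have "natural_iso C C (\<lambda>a. a) (\<lambda>a b f. f) (\<lambda>a. R (F a)) (\<lambda>a b f. f) (Idn C)"
    unfolding natural_iso_def using R Ob_F idn_iso unit_commute by (simp add: iso_in_F Hom Idn Cmp)
  moreover have "natural_iso D D (\<lambda>p. F (R p)) (\<lambda>p q f. f) (\<lambda>p. p) (\<lambda>p q f. f) (Idn D)"
    unfolding natural_iso_def using R idn_iso unit_commute by simp
  ultimately show ?thesis
    unfolding equivalent_categories_def using D category_C[OF D] by blast
qed

text \<open>
  An isomorphism class of \<open>C\<close> is the full preimage under \<open>F\<close> of an isomorphism class of \<open>D\<close>. As \<open>F\<close>
  is onto, taking preimages is injective on all sets of objects, and it turns the sum of classes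
  of \<open>D\<close> into the sum of classes of \<open>C\<close>.
\<close>

lemma grothendieck_iso_class_monoid:
  assumes pl: "\<And>a b. F (pl a b) = pl' (F a) (F b)"
  shows "grothendieck (iso_class_monoid D pl' z') \<cong> grothendieck (iso_class_monoid C pl z)"
proof -
  define \<psi> where "\<psi> Q = {a \<in> Ob C. F a \<in> Q}" for Q
  have class_eq: "\<psi> (iso_class D (F a)) = iso_class C a" for a
    using Ob_F by (auto simp: \<psi>_def iso_class_def iso_in_F)
  have image_\<psi>: "F ` \<psi> Q = Q" if "Q \<subseteq> Ob D" for Q
    using that Ob by (auto simp: \<psi>_def)
  show ?thesis
  proof (rule grothendieck_iso[of \<psi> "Pow (Ob D)"])
    show "inj_on \<psi> (Pow (Ob D))"
      by (rule inj_on_inverseI[of _ "image F"]) (simp add: image_\<psi>)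
    show "carrier (iso_class_monoid D pl' z') \<subseteq> Pow (Ob D)"
      by (auto simp: iso_class_monoid_def iso_class_def)
    show "\<psi> ` carrier (iso_class_monoid D pl' z') = carrier (iso_class_monoid C pl z)"
      by (simp add: iso_class_monoid_def Ob[symmetric] image_image class_eq)
    fix P Q assume PQ: "P \<in> Pow (Ob D)" "Q \<in> Pow (Ob D)"
    have "\<psi> P \<otimes>\<^bsub>iso_class_monoid C pl z\<^esub> \<psi> Q = (\<Union>a\<in>\<psi> P. \<Union>b\<in>\<psi> Q. \<psi> (iso_class D (pl' (F a) (F b))))"
      by (simp add: iso_class_monoid_def class_eq[symmetric] pl)
    also have "\<dots> = (\<Union>p\<in>F ` \<psi> P. \<Union>q\<in>F ` \<psi> Q. \<psi> (iso_class D (pl' p q)))"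
      by simp
    also have "\<dots> = (\<Union>p\<in>P. \<Union>q\<in>Q. \<psi> (iso_class D (pl' p q)))"
      using PQ by (simp only: image_\<psi> Pow_iff)
    also have "\<dots> = \<psi> (P \<otimes>\<^bsub>iso_class_monoid D pl' z'\<^esub> Q)"
      by (auto simp: iso_class_monoid_def \<psi>_def)
    finally show "P \<otimes>\<^bsub>iso_class_monoid D pl' z'\<^esub> Q \<in> Pow (Ob D) \<and>
        \<psi> (P \<otimes>\<^bsub>iso_class_monoid D pl' z'\<^esub> Q) = \<psi> P \<otimes>\<^bsub>iso_class_monoid C pl z\<^esub> \<psi> Q"
      by (auto simp: iso_class_monoid_def iso_class_def)
  qed
qed

end


section \<open>Bundle gerbe modules and twisted bundles\<close>

definition forget_metric :: "'y bg_module \<Rightarrow> ('y, 'y \<times> 'y) twisted_bundle" where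
  "forget_metric E = \<lparr>tvb_bundle = bgm_bundle E, tvb_act = bgm_act E\<rparr>"

lemma pts_Y2: "pts (Y2 Y M \<pi>) = {(y1, y2). y1 \<in> pts Y \<and> y2 \<in> pts Y \<and> \<pi> y1 = \<pi> y2}"
  by (auto simp: Y2_def submanifold_def prod_manifold_def)

lemma pts_Y3: "pts (Y3 Y M \<pi>) = {(y1, y2, y3). y1 \<in> pts Y \<and> y2 \<in> pts Y \<and> y3 \<in> pts Y \<and> \<pi> y1 = \<pi> y2 \<and> \<pi> y2 = \<pi> y3}"
  by (auto simp: Y3_def submanifold_def prod_manifold_def)

lemma pts_composables_fibre_groupoid:
  "pts (composables (fibre_groupoid Y M \<pi>)) = (\<lambda>(y1, y2, y3). ((y1, y2), (y2, y3))) ` pts (Y3 Y M \<pi>)"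
  by (auto simp: composables_def submanifold_def prod_manifold_def fibre_groupoid_def pts_Y2 pts_Y3 image_iff)

text \<open>
  The trivialization of the associated gerbe is the bundle gerbe product followed by the pairing
  with \<open>bg_dual\<close>, which is nondegenerate; so the product recovered from it is the original one.
\<close>

lemma gg_prod_assoc_gerbe:
  assumes B: "is_bundle_gerbe B" and y: "(y1, y2, y3) \<in> pts (bg_Y3 B)"
  shows "gg_prod (bg_groupoid B) (assoc_gerbe B) (y1, y2) (y2, y3) = bg_prod B (y1, y2, y3)"
proof -
  have line: "vb_rank (bg_L B) p = 1" if "p \<in> pts (bg_Y2 B)" for p
    using B that unfolding is_bundle_gerbe_def line_bundle_def by blast
  have y': "(y1, y2) \<in> pts (bg_Y2 B)" "(y2, y3) \<in> pts (bg_Y2 B)" "(y1, y3) \<in> pts (bg_Y2 B)" "(y3, y1) \<in> pts (bg_Y2 B)"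
    using y by (auto simp: pts_Y2 pts_Y3)
  have dual: "bundle_iso (bg_Y2 B) (bg_L B) (dual_bundle (pullback (bg_Y2 B) (\<lambda>(y1, y2). (y2, y1)) (bg_L B))) (bg_dual B)"
    and prod: "bundle_iso (bg_Y3 B)
       (tensor_bundle (pullback (bg_Y3 B) (\<lambda>(y1, y2, y3). (y1, y2)) (bg_L B))
                      (pullback (bg_Y3 B) (\<lambda>(y1, y2, y3). (y2, y3)) (bg_L B)))
       (pullback (bg_Y3 B) (\<lambda>(y1, y2, y3). (y1, y3)) (bg_L B)) (bg_prod B)"
    using B unfolding is_bundle_gerbe_def by blast+
  define D where "D = bg_dual B (y3, y1)"
  have D: "D \<in> carrier_mat 1 1" "invertible_mat D"
    using bundle_mapD(1)[OF conjunct1[OF dual[unfolded bundle_iso_def]] y'(4)]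
      bspec[OF conjunct2[OF dual[unfolded bundle_iso_def]] y'(4)]
    by (simp_all add: D_def dual_bundle_def pullback_def line[OF y'(3)] line[OF y'(4)])
  define P where "P = bg_prod B (y1, y2, y3)"
  have P: "P \<in> carrier_mat 1 1"
    using bundle_mapD(1)[OF conjunct1[OF prod[unfolded bundle_iso_def]] y]
    by (simp add: P_def tensor_bundle_def pullback_def line[OF y'(1)] line[OF y'(2)] line[OF y'(3)])
  have cancel: "Q = P" if "Q \<in> carrier_mat 1 1" "D * Q = D * P" for Q
  proof -
    note inv = minv_inverse[OF D]
    have "Q = minv D * (D * Q)"
      using assoc_mult_mat[OF inv(1) D(1) that(1)] inv(3) left_mult_one_mat[OF that(1)] by simp
    also have "\<dots> = P"
      using assoc_mult_mat[OF inv(1) D(1) P] inv(3) left_mult_one_mat[OF P] that(2) by simp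
    finally show ?thesis .
  qed
  have "gg_prod (bg_groupoid B) (assoc_gerbe B) (y1, y2) (y2, y3) =
      (THE Q. Q \<in> carrier_mat 1 1 \<and> D * Q = D * P)"
    unfolding gg_prod_def
    by (simp add: assoc_gerbe_def fibre_groupoid_def line[OF y'(1)] line[OF y'(2)] line[OF y'(3)] line[OF y'(4)]
        kron_one_1_right ev_mat_1x1[OF D(1)] D_def[symmetric] P_def[symmetric] del: One_nat_def)
  also have "\<dots> = P"
    by (rule the_equality) (use P cancel in auto)
  finally show ?thesis by (simp add: P_def)
qed

lemma is_bg_module_iff:
  assumes B: "is_bundle_gerbe B"
  shows "is_bg_module B E \<longleftrightarrow>
    is_twisted_bundle (bg_groupoid B) (assoc_gerbe B) (forget_metric E) \<and>
    hermitian_metric (bg_Y B) (bgm_bundle E) (bgm_metric E)"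
proof -
  let ?G = "bg_groupoid B"
  have "(\<forall>(g, h)\<in>pts (composables ?G).
        bgm_act E g * (1\<^sub>m (vb_rank (bg_L B) g) \<otimes>\<^sub>k bgm_act E h) =
        bgm_act E (fst g, snd h) * (gg_prod ?G (assoc_gerbe B) g h \<otimes>\<^sub>k 1\<^sub>m (vb_rank (bgm_bundle E) (snd h)))) \<longleftrightarrow>
     (\<forall>(y1, y2, y3)\<in>pts (bg_Y3 B).
        bgm_act E (y1, y2) * (1\<^sub>m (vb_rank (bg_L B) (y1, y2)) \<otimes>\<^sub>k bgm_act E (y2, y3)) =
        bgm_act E (y1, y3) * (bg_prod B (y1, y2, y3) \<otimes>\<^sub>k 1\<^sub>m (vb_rank (bgm_bundle E) y3)))"
    unfolding pts_composables_fibre_groupoid ball_simps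
    by (rule ball_cong[OF refl]) (auto simp: gg_prod_assoc_gerbe[OF B])
  then show ?thesis
    unfolding is_bg_module_def is_twisted_bundle_def
    by (simp add: forget_metric_def assoc_gerbe_def[of B] fibre_groupoid_def[of "bg_Y B" "bg_M B" "bg_proj B"]) blast
qed

text \<open>Every twisted bundle underlies a module, because a hermitian metric can be chosen on it.\<close>

lemma forgetful_forget_metric:
  assumes B: "is_bundle_gerbe B"
  shows "forgetful (bgm_category B) (tvb_category (bg_groupoid B) (assoc_gerbe B)) forget_metric"
proof
  let ?G = "bg_groupoid B" and ?L = "assoc_gerbe B"
  show "forget_metric ` Ob (bgm_category B) = Ob (tvb_category ?G ?L)"
  proof
    show "forget_metric ` Ob (bgm_category B) \<subseteq> Ob (tvb_category ?G ?L)"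
      by (auto simp: bgm_category_def tvb_category_def is_bg_module_iff[OF B])
    show "Ob (tvb_category ?G ?L) \<subseteq> forget_metric ` Ob (bgm_category B)"
    proof
      fix E assume "E \<in> Ob (tvb_category ?G ?L)"
      then have E: "is_twisted_bundle ?G ?L E" by (simp add: tvb_category_def)
      then have "vector_bundle (bg_Y B) (tvb_bundle E)"
        by (simp add: is_twisted_bundle_def fibre_groupoid_def)
      moreover have "smooth_manifold (bg_Y B)"
        using B unfolding is_bundle_gerbe_def by blast
      ultimately obtain h where h: "hermitian_metric (bg_Y B) (tvb_bundle E) h"
        using hermitian_metric_exists by blast
      let ?E = "\<lparr>bgm_bundle = tvb_bundle E, bgm_metric = h, bgm_act = tvb_act E\<rparr>"
      have "forget_metric ?E = E" by (simp add: forget_metric_def)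
      with E h have "is_bg_module B ?E" by (simp add: is_bg_module_iff[OF B])
      with \<open>forget_metric ?E = E\<close> show "E \<in> forget_metric ` Ob (bgm_category B)"
        by (intro image_eqI[of _ _ ?E]) (simp_all add: bgm_category_def)
    qed
  qed
  show "Hom (bgm_category B) a b = Hom (tvb_category ?G ?L) (forget_metric a) (forget_metric b)" for a b
    by (simp add: bgm_category_def tvb_category_def bgm_hom_def tvb_hom_def forget_metric_def
        fibre_groupoid_def assoc_gerbe_def case_prod_unfold)
qed (simp_all add: bgm_category_def tvb_category_def forget_metric_def fibre_groupoid_def)

theorem theorem7p3p13:
  fixes B :: "('y, 'm) bundle_gerbe"
  assumes "is_bundle_gerbe B"
  shows "equivalent_categories (bgm_category B) (tvb_category (bg_groupoid B) (assoc_gerbe B)) \<and>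
         K_gpd (bg_groupoid B) (assoc_gerbe B) \<cong> K_bg B"
proof
  interpret forgetful "bgm_category B" "tvb_category (bg_groupoid B) (assoc_gerbe B)" forget_metric
    using assms by (rule forgetful_forget_metric)
  have "category (tvb_category (bg_groupoid B) (assoc_gerbe B))"
  proof (rule category_twisted_bundles)
    show "smooth_manifold (gobj (bg_groupoid B))"
      using assms by (simp add: is_bundle_gerbe_def fibre_groupoid_def)
    show "gsrc (bg_groupoid B) g \<in> pts (gobj (bg_groupoid B)) \<and> gtgt (bg_groupoid B) g \<in> pts (gobj (bg_groupoid B))"
      if "g \<in> pts (garr (bg_groupoid B))" for g
      using that by (auto simp: fibre_groupoid_def pts_Y2)
    show "vb_rank (gg_L (assoc_gerbe B)) g = 1" if "g \<in> pts (garr (bg_groupoid B))" for g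
      using assms that by (simp add: is_bundle_gerbe_def line_bundle_def fibre_groupoid_def assoc_gerbe_def)
  qed
  then show "equivalent_categories (bgm_category B) (tvb_category (bg_groupoid B) (assoc_gerbe B))"
    by (rule equivalent)
  show "K_gpd (bg_groupoid B) (assoc_gerbe B) \<cong> K_bg B"
    unfolding K_gpd_def K_bg_def
    by (rule grothendieck_iso_class_monoid)
      (simp add: forget_metric_def bgm_sum_def tvb_sum_def)
qed

end
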